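(* For every integer $d \geq 1$ there exist, up to unimodular equivalence, only finitely many $d$-dimensional sporadic $F$-hollow lattice polytopes $P \subset \mathbb{R}^d$.
   Context: A lattice polytope in $\mathbb{R}^d$ is a convex polytope all of whose vertices lie in $\mathbb{Z}^d$. For a $d$-dimensional convex polytope $P \subset \mathbb{R}^d$ and ${\bf a} \in \mathbb{Z}^d$, put $\mathrm{Min}_P({\bf a}) := \min_{{\bf y} \in P} \sum_{i=1}^d a_i y_i$. The Fine interior of $P$ is $$F(P) := \Big\{ {\bf y} \in \mathbb{R}^d \;\Big|\; \sum_{i=1}^d a_i y_i \geq \mathrm{Min}_P({\bf a}) + 1 \ \text{ for all } {\bf a} \in \mathbb{Z}^d \setminus \{0\} \Big\}.$$ The polytope $P$ is called $F$-hollow if $F(P) = \emptyset$. Two lattice polytopes $P_1, P_2 \subset \mathbb{R}^d$ are unimodular equivalent if there is an affine isomorphism $\varphi : \mathbb{R}^d \to \mathbb{R}^d$ with $\varphi(\mathbb{Z}^d) = \mathbb{Z}^d$ and $\varphi(P_1) = P_2$. A $k$-dimensional lattice polytope $P' \subset \mathbb{R}^k$ ($1 \leq k < d$) is a lattice projection of a $d$-dimensional lattice polytope $P \subset \mathbb{R}^d$ if there is an affine map $\pi : \mathbb{R}^d \to \mathbb{R}^k$ with $\pi(\mathbb{Z}^d) = \mathbb{Z}^k$ and $\pi(P) = P'$. A $d$-dimensional $F$-hollow lattice polytope $P$ is called sporadic if it does not admit any lattice projection onto a $k$-dimensional $F$-hollow lattice polytope $P'$ with $1 \leq k \leq d-1$.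 *)

theory Defs
  imports "HOL-Analysis.Analysis"
begin

text \<open>
  For an index set \<open>I\<close> with \<open>card I = k\<close>, the Euclidean space of dimension \<open>k\<close> is realised as
  the coordinate subspace of \<open>real ^ 'n\<close> spanned by the coordinates in \<open>I\<close>; the ambient space
  itself is the case \<open>I = UNIV\<close>.  This makes it possible to quantify over all target dimensions
  \<open>k < CARD('n)\<close> of lattice projections inside one formula.
\<close>

definition coord_space :: "'n set \<Rightarrow> (real ^ 'n) set" where
  "coord_space I = {x. \<forall>i. i \<notin> I \<longrightarrow> x $ i = 0}"

definition coord_lattice :: "'n set \<Rightarrow> (real ^ 'n) set" where
  "coord_lattice I = {x \<in> coord_space I. \<forall>i. x $ i \<in> \<int>}"

definition lattice_polytope :: "'n::finite set \<Rightarrow> (real ^ 'n) set \<Rightarrow> bool" where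
  "lattice_polytope I P \<longleftrightarrow>
     polytope P \<and> P \<subseteq> coord_space I \<and> (\<forall>v. v extreme_point_of P \<longrightarrow> v \<in> coord_lattice I)"

definition full_dim_lattice_polytope :: "'n::finite set \<Rightarrow> (real ^ 'n) set \<Rightarrow> bool" where
  "full_dim_lattice_polytope I P \<longleftrightarrow> lattice_polytope I P \<and> aff_dim P = int (card I)"

text \<open>The infimum is attained, hence a minimum, for every nonempty polytope \<open>P\<close>.\<close>

definition Min_on :: "(real ^ 'n::finite) set \<Rightarrow> real ^ 'n \<Rightarrow> real" where
  "Min_on P a = (INF y\<in>P. a \<bullet> y)"

definition fine_interior :: "'n::finite set \<Rightarrow> (real ^ 'n) set \<Rightarrow> (real ^ 'n) set" where
  "fine_interior I P =
     {y \<in> coord_space I. \<forall>a \<in> coord_lattice I - {0}. a \<bullet> y \<ge> Min_on P a + 1}"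

definition F_hollow :: "'n::finite set \<Rightarrow> (real ^ 'n) set \<Rightarrow> bool" where
  "F_hollow I P \<longleftrightarrow> fine_interior I P = {}"

definition affine_map :: "('a::real_vector \<Rightarrow> 'b::real_vector) \<Rightarrow> bool" where
  "affine_map f \<longleftrightarrow> (\<exists>g c. linear g \<and> f = (\<lambda>x. g x + c))"

definition unimodular_equivalence :: "((real ^ 'n::finite) set \<times> (real ^ 'n) set) set" where
  "unimodular_equivalence =
     {(P, Q). lattice_polytope UNIV P \<and> lattice_polytope UNIV Q \<and>
        (\<exists>\<phi>. affine_map \<phi> \<and> bij \<phi> \<and> \<phi> ` coord_lattice UNIV = coord_lattice UNIV \<and> \<phi> ` P = Q)}"

definition lattice_projection ::
    "(real ^ 'n::finite) set \<Rightarrow> 'n set \<Rightarrow> (real ^ 'n) set \<Rightarrow> bool" where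
  "lattice_projection P I P' \<longleftrightarrow>
     (\<exists>\<pi> :: real ^ 'n \<Rightarrow> real ^ 'n. affine_map \<pi> \<and> range \<pi> \<subseteq> coord_space I \<and>
        \<pi> ` coord_lattice UNIV = coord_lattice I \<and> \<pi> ` P = P')"

definition sporadic_F_hollow :: "(real ^ 'n::finite) set \<Rightarrow> bool" where
  "sporadic_F_hollow P \<longleftrightarrow>
     full_dim_lattice_polytope UNIV P \<and> F_hollow UNIV P \<and>
     \<not> (\<exists>I P'. 1 \<le> card I \<and> card I < CARD('n) \<and>
            full_dim_lattice_polytope I P' \<and> F_hollow I P' \<and> lattice_projection P I P')"

end

theory Submission
  imports Defs
begin

text \<open>
  Write \<open>m a\<close> for \<open>Min_on P a\<close>.  By compactness and the Farkas lemma, \<open>P\<close> is F-hollow only if there are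
  boundedly many nonzero integral normals \<open>a \<in> A\<close> with weights \<open>l a \<ge> 0\<close> such that
  \<open>(\<Sum>a\<in>A. l a *\<^sub>R a) = 0\<close> and \<open>(\<Sum>a\<in>A. l a * (m a + 1)) > 0\<close> (lemma
  \<open>F_hollow_imp_certificate\<close>).  On \<open>P\<close> the nonnegative functions \<open>u a v = a \<bullet> v - m a\<close> then have a
  constant weighted sum smaller than the total weight.  In particular the normal of largest weight
  has bounded width on \<open>P\<close>.

  Suppose that the widths are already bounded for normals \<open>B \<subseteq> A\<close> that do not span the space.  If
  \<open>B \<noteq> {}\<close>, a sporadic \<open>P\<close> projects along a lattice direction orthogonal to \<open>B\<close> to a polytope that is
  not F-hollow, and this gives a point \<open>y\<close> with \<open>u a y \<ge> 1\<close> for all nonzero integral \<open>a\<close> in \<open>span B\<close>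
  (\<open>sporadic_imp_relatively_nonhollow\<close>).  Diophantine approximation strengthens this: for every real
  \<open>a\<close> in \<open>span B\<close>, the number \<open>u a y\<close> is at least a fixed proportion \<open>\<delta>\<close> of the width of \<open>P\<close> along
  \<open>a\<close> (\<open>sublinear_lower_bound\<close>).  Now let \<open>a\<close> be the weighted sum of the normals in \<open>B\<close>.  The
  certificate keeps \<open>u (- a) y\<close> below the total weight \<open>s\<close> of \<open>A - B\<close>, so the width along \<open>a\<close> is less
  than \<open>s / \<delta>\<close>.  Hence the part of the constant weighted sum that belongs to \<open>A - B\<close> is at most
  \<open>s * (1 + 1 / \<delta>)\<close> on \<open>P\<close>, and the heaviest normal in \<open>A - B\<close> has bounded width as well
  (\<open>next_width_bound\<close>).  Since \<open>card A\<close> is bounded, after finitely many rounds \<open>P\<close> has widths below a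
  constant depending only on the dimension along a spanning set of integral normals
  (\<open>bounded_widths_on_spanning_set\<close>).

  Lattice polytopes with such bounded widths form finitely many classes
  (\<open>finite_classes_bounded_width\<close>): using a basis of these normals as coordinates, \<open>P\<close> is determined up
  to equivalence by a set of lattice points in a bounded box and by the image of the integer lattice,
  which lies between the lattice generated by these points and the integer lattice itself.
\<close>

section \<open>The integer lattice\<close>

abbreviation integer_lattice :: "(real ^ 'n::finite) set" where
  "integer_lattice \<equiv> coord_lattice UNIV"

lemma integer_lattice_iff: "x \<in> integer_lattice \<longleftrightarrow> (\<forall>i. x $ i \<in> \<int>)"
  by (simp add: coord_lattice_def coord_space_def)

lemma integer_lattice_0: "0 \<in> integer_lattice"
  by (simp add: integer_lattice_iff)

lemma integer_lattice_add: "x \<in> integer_lattice \<Longrightarrow> y \<in> integer_lattice \<Longrightarrow> x + y \<in> integer_lattice"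
  by (simp add: integer_lattice_iff)

lemma integer_lattice_diff: "x \<in> integer_lattice \<Longrightarrow> y \<in> integer_lattice \<Longrightarrow> x - y \<in> integer_lattice"
  by (simp add: integer_lattice_iff)

lemma integer_lattice_uminus: "x \<in> integer_lattice \<Longrightarrow> - x \<in> integer_lattice"
  by (simp add: integer_lattice_iff)

lemma integer_lattice_scaleR: "c \<in> \<int> \<Longrightarrow> x \<in> integer_lattice \<Longrightarrow> c *\<^sub>R x \<in> integer_lattice"
  by (simp add: integer_lattice_iff)

lemma integer_lattice_sum:
  "(\<And>i. i \<in> S \<Longrightarrow> f i \<in> integer_lattice) \<Longrightarrow> sum f S \<in> integer_lattice"
  by (simp add: integer_lattice_iff Ints_sum)

lemma integer_lattice_axis: "axis i 1 \<in> integer_lattice"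
  by (simp add: integer_lattice_iff axis_def)

lemma integer_lattice_inner:
  "x \<in> integer_lattice \<Longrightarrow> y \<in> integer_lattice \<Longrightarrow> x \<bullet> y \<in> \<int>"
  by (simp add: integer_lattice_iff inner_vec_def Ints_sum Ints_mult)

section \<open>Minimum and lattice width of a compact set in a direction\<close>

lemma Min_on_le:
  assumes "compact P" "v \<in> P" shows "Min_on P a \<le> a \<bullet> v"
proof -
  have "bdd_below ((\<lambda>y. a \<bullet> y) ` P)"
    by (intro bounded_imp_bdd_below compact_imp_bounded compact_continuous_image
        continuous_intros assms(1))
  then show ?thesis unfolding Min_on_def by (rule cINF_lower) fact
qed

lemma Min_on_greatest:
  assumes "P \<noteq> {}" "\<And>v. v \<in> P \<Longrightarrow> l \<le> a \<bullet> v" shows "l \<le> Min_on P a"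
  unfolding Min_on_def using assms by (intro cINF_greatest)

lemma Min_on_0: "P \<noteq> {} \<Longrightarrow> Min_on P 0 = 0"
  by (simp add: Min_on_def)

lemma Min_on_add:
  assumes "compact P" "P \<noteq> {}" shows "Min_on P a + Min_on P b \<le> Min_on P (a + b)"
  using assms by (intro Min_on_greatest) (auto simp: inner_add_left intro!: add_mono Min_on_le)

lemma Min_on_scaleR:
  assumes "compact P" "P \<noteq> {}" "0 \<le> t" shows "Min_on P (t *\<^sub>R a) = t * Min_on P a"
proof (cases "t = 0")
  case False
  with assms have t: "t > 0" by simp
  show ?thesis
  proof (rule antisym)
    have "Min_on P (t *\<^sub>R a) / t \<le> Min_on P a"
    proof (rule Min_on_greatest[OF assms(2)])
      fix v assume "v \<in> P"
      from Min_on_le[OF assms(1) this, of "t *\<^sub>R a"] t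
      show "Min_on P (t *\<^sub>R a) / t \<le> a \<bullet> v" by (simp add: field_simps)
    qed
    with t show "Min_on P (t *\<^sub>R a) \<le> t * Min_on P a" by (simp add: field_simps)
    show "t * Min_on P a \<le> Min_on P (t *\<^sub>R a)"
      using assms t by (intro Min_on_greatest) (auto intro!: mult_left_mono Min_on_le)
  qed
qed (use assms in \<open>simp add: Min_on_0\<close>)

lemma Min_on_sum:
  assumes "compact P" "P \<noteq> {}" "finite A" "\<And>a. a \<in> A \<Longrightarrow> 0 \<le> l a"
  shows "(\<Sum>a\<in>A. l a * Min_on P a) \<le> Min_on P (\<Sum>a\<in>A. l a *\<^sub>R a)"
  using assms(1,2,4)
  by (intro Min_on_greatest)
     (auto simp: inner_sum_left intro!: sum_mono mult_left_mono Min_on_le)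

definition width_on :: "(real ^ 'n::finite) set \<Rightarrow> real ^ 'n \<Rightarrow> real" where
  "width_on P a = - Min_on P (- a) - Min_on P a"

lemma inner_le_width_on:
  assumes "compact P" "v \<in> P" "w \<in> P" shows "a \<bullet> v - a \<bullet> w \<le> width_on P a"
  using Min_on_le[OF assms(1,2), of "- a"] Min_on_le[OF assms(1,3), of "a"]
  unfolding width_on_def by simp

lemma width_on_le:
  assumes "P \<noteq> {}" "\<And>v. v \<in> P \<Longrightarrow> a \<bullet> v - Min_on P a \<le> w" shows "width_on P a \<le> w"
proof -
  have "- w - Min_on P a \<le> Min_on P (- a)"
    using assms by (intro Min_on_greatest) (fastforce simp: inner_minus_left)+
  then show ?thesis unfolding width_on_def by simp
qed

lemma width_on_eq_excess:
  "width_on P a = (a \<bullet> y - Min_on P a) + (- a \<bullet> y - Min_on P (- a))"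
  by (simp add: width_on_def)

section \<open>Sublinear functionals bounded below on lattice points\<close>

definition sublinear :: "('a::real_vector \<Rightarrow> real) \<Rightarrow> bool" where
  "sublinear g \<longleftrightarrow> (\<forall>x y. g (x + y) \<le> g x + g y) \<and> (\<forall>t x. 0 \<le> t \<longrightarrow> g (t *\<^sub>R x) = t * g x)"

text \<open>
  For a point \<open>y\<close>, the excess \<open>a \<bullet> y - Min_on P a\<close> measures how deep \<open>y\<close> lies inside the supporting
  half-space of \<open>P\<close> with inner normal \<open>a\<close>.  It is the support function of \<open>P - y\<close> at \<open>- a\<close>, hence
  sublinear in \<open>a\<close>, and the excesses at \<open>a\<close> and \<open>- a\<close> add up to the width of \<open>P\<close> along \<open>a\<close>.
\<close>
lemma sublinear_excess:
  assumes "compact P" "P \<noteq> {}" shows "sublinear (\<lambda>a. a \<bullet> y - Min_on P a)"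
  unfolding sublinear_def using Min_on_add[OF assms] Min_on_scaleR[OF assms]
  by (auto simp: inner_add_left algebra_simps)

lemma sublinear_sum_le:
  assumes g: "sublinear g" and "finite C"
    and bound: "\<And>c. c \<in> C \<Longrightarrow> g c \<le> D" "\<And>c. c \<in> C \<Longrightarrow> g (- c) \<le> D"
  shows "g (\<Sum>c\<in>C. e c *\<^sub>R c) \<le> (\<Sum>c\<in>C. \<bar>e c\<bar>) * D"
  using \<open>finite C\<close> bound
proof (induction C rule: finite_induct)
  case empty
  have "g (0 *\<^sub>R 0) = 0 * g 0" using g unfolding sublinear_def by blast
  then show ?case by simp
next
  case (insert c C)
  have "g (e c *\<^sub>R c) \<le> \<bar>e c\<bar> * D"
  proof (cases "0 \<le> e c")
    case True
    then have "g (e c *\<^sub>R c) = e c * g c" using g unfolding sublinear_def by blast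
    with True insert.prems show ?thesis by (simp add: mult_left_mono)
  next
    case False
    then have "g ((- e c) *\<^sub>R (- c)) = (- e c) * g (- c)"
      using g unfolding sublinear_def by (metis less_eq_real_def neg_0_le_iff_le not_le)
    with False insert.prems(2)[of c] show ?thesis by (simp add: mult_left_mono_neg)
  qed
  moreover have "g (e c *\<^sub>R c + (\<Sum>c\<in>C. e c *\<^sub>R c)) \<le> g (e c *\<^sub>R c) + g (\<Sum>c\<in>C. e c *\<^sub>R c)"
    using g unfolding sublinear_def by blast
  ultimately show ?case using insert by (simp add: algebra_simps) 
qed

lemma Dirichlet_approx_on:
  fixes \<theta> :: "'a \<Rightarrow> real"
  assumes "Q > 0" "finite C"
  obtains q :: int and p :: "'a \<Rightarrow> int"
  where "0 < q" "q \<le> int (Q ^ card C)" "\<And>c. c \<in> C \<Longrightarrow> \<bar>q * \<theta> c - p c\<bar> < 1 / Q"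
proof -
  obtain h where h: "bij_betw h {..<card C} C"
    using ex_bij_betw_nat_finite[OF assms(2)] by (auto simp: atLeast0LessThan)
  obtain q p where qp: "0 < q" "q \<le> int (Q ^ card C)"
    "\<And>i. i < card C \<Longrightarrow> \<bar>of_int q * (\<theta> \<circ> h) i - of_int (p i)\<bar> < 1 / Q"
    using Dirichlet_approx_simult[OF assms(1), of "card C" "\<theta> \<circ> h"] by blast
  show ?thesis
  proof (rule that[OF qp(1,2)])
    fix c assume c: "c \<in> C"
    let ?i = "inv_into {..<card C} h c"
    have "?i < card C" "h ?i = c"
      using h c by (auto simp: bij_betw_def f_inv_into_f) (metis inv_into_into lessThan_iff)
    with qp(3)[of ?i] show "\<bar>q * \<theta> c - (p \<circ> inv_into {..<card C} h) c\<bar> < 1 / Q" by simp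
  qed
qed

text \<open>
  Let \<open>g\<close> be the excess at a point satisfying the inequalities of the Fine interior for the integral
  vectors in \<open>span C\<close>.  Then \<open>g \<ge> 1\<close> at those of them that are nonzero, and simultaneous
  Diophantine approximation carries the bound to real directions: after scaling the largest absolute
  value of a coefficient of \<open>a\<close> to 1, some multiple \<open>q *\<^sub>R a\<close> with \<open>1 \<le> q \<le> Q ^ card C\<close> is so
  close to a nonzero integral \<open>z\<close> that sublinearity turns \<open>g z \<ge> 1\<close> into \<open>q * g a \<ge> 1 / 2\<close>.  Since \<open>g a + g (- a)\<close> is bounded above in terms of \<open>D\<close>, the
  excess is at least a fixed proportion of the width.  The point is that \<open>\<delta>\<close> depends only on \<open>N\<close>
  and \<open>D\<close>.
\<close>
lemma sublinear_lower_bound: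
  fixes N :: nat and D :: real
  assumes N: "N > 0" and D: "D \<ge> 1"
  shows "\<exists>\<delta>>0. \<forall>g (C :: (real ^ 'n::finite) set) a.
       sublinear g \<and> finite C \<and> card C \<le> N \<and> independent C \<and> C \<subseteq> integer_lattice \<and>
       (\<forall>z \<in> integer_lattice \<inter> span C - {0}. 1 \<le> g z) \<and> (\<forall>c\<in>C. g c + g (- c) \<le> D) \<and> a \<in> span C
       \<longrightarrow> \<delta> * (g a + g (- a)) \<le> g a"
proof -
  \<comment> \<open>The total approximation error \<open>N * (1 / Q) * D\<close> has to stay below \<open>1 / 2\<close>.\<close>
  obtain Q :: nat where Q: "real Q \<ge> 2 * N * D" using real_arch_simple by blast
  have "1 * 1 \<le> real N * D" using N D by (intro mult_mono) auto
  then have ND: "2 \<le> 2 * N * D" by simp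
  with Q have Q1: "Q \<ge> 1" "real Q > 0" by linarith+
  define \<delta> where "\<delta> = 1 / (4 * N * D * Q ^ N)"
  have "\<delta> > 0" unfolding \<delta>_def using N D Q1 by simp
  moreover have "\<delta> * (g a + g (- a)) \<le> g a"
    if g: "sublinear g" and C: "finite C" "card C \<le> N" "independent C" "C \<subseteq> integer_lattice"
      and one: "\<And>z. \<lbrakk>z \<in> integer_lattice; z \<in> span C; z \<noteq> 0\<rbrakk> \<Longrightarrow> 1 \<le> g z"
      and wd: "\<And>c. c \<in> C \<Longrightarrow> g c + g (- c) \<le> D" and a: "a \<in> span C"
    for g and C :: "(real ^ 'n) set" and a
  proof -
    \<comment> \<open>Both \<open>c\<close> and \<open>- c\<close> are nonzero lattice points, so \<open>g\<close> is positive at each of them and neither exceeds the sum.\<close>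
    have bnd: "g c \<le> D" "g (- c) \<le> D" if "c \<in> C" for c
    proof -
      have "c \<noteq> 0" using that C(3) dependent_zero by metis
      moreover have "c \<in> span C" "- c \<in> span C"
        using that by (auto intro: span_base span_neg)
      ultimately have "1 \<le> g c" "1 \<le> g (- c)"
        using that C(4) by (auto intro!: one integer_lattice_uminus)
      with wd[OF that] show "g c \<le> D" "g (- c) \<le> D" by linarith+
    qed
    obtain \<alpha> where \<alpha>: "a = (\<Sum>c\<in>C. \<alpha> c *\<^sub>R c)"
      using a C(1) by (auto simp: span_finite)
    show ?thesis
    proof (cases "\<forall>c\<in>C. \<alpha> c = 0")
      case True
      then have "a = 0" using \<alpha> by simp
      moreover have "g (0 *\<^sub>R 0) = 0 * g 0" using g unfolding sublinear_def by blast
      ultimately show ?thesis by simp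
    next
      case False
      define \<mu> where "\<mu> = Max ((\<lambda>c. \<bar>\<alpha> c\<bar>) ` C)"
      have Cne: "C \<noteq> {}" using False by auto
      have le\<mu>: "\<bar>\<alpha> c\<bar> \<le> \<mu>" if "c \<in> C" for c
        unfolding \<mu>_def using C(1) that by simp
      have "\<mu> \<in> (\<lambda>c. \<bar>\<alpha> c\<bar>) ` C" unfolding \<mu>_def using C(1) Cne by (intro Max_in) auto
      then obtain c0 where c0: "c0 \<in> C" "\<bar>\<alpha> c0\<bar> = \<mu>" by auto
      have \<mu>: "\<mu> > 0" using False le\<mu> by (fastforce simp: not_less dest: order_trans)
      obtain q p where qp: "0 < q" "q \<le> int (Q ^ card C)"
        "\<And>c. c \<in> C \<Longrightarrow> \<bar>of_int q * (\<alpha> c / \<mu>) - of_int (p c)\<bar> < 1 / Q"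
        using Dirichlet_approx_on[of Q C "\<lambda>c. \<alpha> c / \<mu>"] Q1 C(1) by auto
      define z where "z = (\<Sum>c\<in>C. of_int (p c) *\<^sub>R c)"
      \<comment> \<open>The coefficient at \<open>c0\<close> is \<open>1\<close> or \<open>-1\<close> after scaling, so its approximation cannot vanish; independence gives \<open>z \<noteq> 0\<close>.\<close>
      have "p c0 \<noteq> 0"
      proof
        assume "p c0 = 0"
        with qp(3)[OF c0(1)] have "\<bar>of_int q * (\<alpha> c0 / \<mu>)\<bar> < 1 / Q" by simp
        moreover have "\<bar>of_int q * (\<alpha> c0 / \<mu>)\<bar> = of_int q"
          using qp(1) c0(2) \<mu> by (simp add: abs_mult)
        moreover have "1 / real Q \<le> 1" using Q1 by simp
        ultimately have "of_int q < (1::real)" by linarith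
        with qp(1) show False by simp
      qed
      then have "z \<noteq> 0"
        using C(1,3) c0(1) unfolding z_def independent_explicit by auto
      moreover have "z \<in> integer_lattice"
        unfolding z_def using C(4) by (auto intro!: integer_lattice_sum integer_lattice_scaleR)
      moreover have "z \<in> span C"
        unfolding z_def by (intro span_sum span_scale span_base)
      ultimately have gz: "1 \<le> g z" using one by blast
      define e where "e c = of_int (p c) - of_int q * (\<alpha> c / \<mu>)" for c
      have "(of_int q / \<mu>) *\<^sub>R a + (\<Sum>c\<in>C. e c *\<^sub>R c) = z"
        unfolding z_def \<alpha> e_def scaleR_sum_right sum.distrib[symmetric]
        by (intro sum.cong refl) (simp add: algebra_simps)
      then have "g z \<le> g ((of_int q / \<mu>) *\<^sub>R a) + g (\<Sum>c\<in>C. e c *\<^sub>R c)"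
        using g unfolding sublinear_def by metis
      also have "g ((of_int q / \<mu>) *\<^sub>R a) = (of_int q / \<mu>) * g a"
        using g qp(1) \<mu> unfolding sublinear_def by simp
      also have "g (\<Sum>c\<in>C. e c *\<^sub>R c) \<le> (\<Sum>c\<in>C. \<bar>e c\<bar>) * D"
        by (rule sublinear_sum_le[OF g C(1)]) (use bnd in auto)
      also have "\<dots> \<le> (\<Sum>c\<in>C. 1 / Q) * D"
        using D qp(3) by (intro mult_right_mono sum_mono)
          (auto simp: e_def abs_minus_commute less_imp_le)
      also have "\<dots> \<le> N / Q * D"
        using C(2) D Q1 by (intro mult_right_mono) (auto simp: divide_right_mono)
      also have "N / Q * D \<le> 1 / 2" using Q Q1 by (simp add: field_simps)
      finally have low: "1 / 2 \<le> (of_int q / \<mu>) * g a" using gz by linarith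
      have "g a > 0"
      proof (rule ccontr)
        assume "\<not> g a > 0"
        then have "(of_int q / \<mu>) * g a \<le> 0" using qp(1) \<mu> by (intro mult_nonneg_nonpos) auto
        with low show False by linarith
      qed
      have "\<mu> \<le> 2 * of_int q * g a" using low \<mu> by (simp add: field_simps)
      also have "\<dots> \<le> 2 * Q ^ N * g a"
      proof -
        have "of_int q \<le> real (Q ^ card C)" using qp(2) by (metis of_int_le_iff of_int_of_nat_eq)
        also have "\<dots> \<le> Q ^ N" using Q1 C(2) by (simp add: power_increasing)
        finally show ?thesis using \<open>g a > 0\<close> by simp
      qed
      finally have \<mu>le: "\<mu> \<le> 2 * Q ^ N * g a" .
      have su: "(\<Sum>c\<in>C. \<bar>\<alpha> c\<bar>) * D \<le> N * \<mu> * D"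
      proof -
        have "(\<Sum>c\<in>C. \<bar>\<alpha> c\<bar>) \<le> (\<Sum>c\<in>C. \<mu>)" by (intro sum_mono le\<mu>)
        also have "\<dots> \<le> N * \<mu>" using C(2) \<mu> by simp
        finally show ?thesis using D by (simp add: mult_right_mono)
      qed
      have "g a \<le> (\<Sum>c\<in>C. \<bar>\<alpha> c\<bar>) * D"
        unfolding \<alpha> by (rule sublinear_sum_le[OF g C(1)]) (use bnd in auto)
      moreover have "g (- a) \<le> (\<Sum>c\<in>C. \<bar>- \<alpha> c\<bar>) * D"
      proof -
        have "- a = (\<Sum>c\<in>C. (- \<alpha> c) *\<^sub>R c)" unfolding \<alpha> by (simp add: sum_negf)
        then show ?thesis using sublinear_sum_le[OF g C(1) bnd, of "\<lambda>c. - \<alpha> c"] by simp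
      qed
      ultimately have "g a + g (- a) \<le> 2 * (N * \<mu> * D)" using su by simp
      also have "\<dots> \<le> 2 * (N * (2 * Q ^ N * g a) * D)"
        using \<mu>le D by (intro mult_left_mono mult_right_mono) auto
      also have "\<dots> = g a / \<delta>" unfolding \<delta>_def by simp
      finally show ?thesis using \<open>\<delta> > 0\<close> by (simp add: field_simps)
    qed
  qed
  ultimately show ?thesis by (intro exI[of _ \<delta>]) auto
qed

section \<open>A finite certificate of F-hollowness\<close>

text \<open>
  If no combination existed, the compact convex hull of the points \<open>(a, b a)\<close> would miss the closed ray
  \<open>{0} \<times> {0..}\<close>.  A hyperplane strictly separating the two encodes a solution \<open>y\<close> of the system.
  Caratheodory's theorem in the space with one additional coordinate bounds the number of points used.
\<close>
lemma farkas_certificate: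
  fixes A :: "'a::euclidean_space set" and b :: "'a \<Rightarrow> real"
  assumes "finite A" and infeasible: "\<nexists>y. \<forall>a\<in>A. b a \<le> a \<bullet> y"
  obtains S l where "S \<subseteq> A" "card S \<le> DIM('a) + 2" "\<And>a. a \<in> S \<Longrightarrow> 0 \<le> l a"
    "sum l S = 1" "(\<Sum>a\<in>S. l a *\<^sub>R a) = 0" "0 \<le> (\<Sum>a\<in>S. l a * b a)"
proof -
  define G where "G = (\<lambda>a. (a, b a)) ` A"
  define R where "R = {z :: 'a \<times> real. fst z = 0 \<and> 0 \<le> snd z}"
  have R: "convex R" "closed R" "R \<noteq> {}" "(0, t) \<in> R \<longleftrightarrow> 0 \<le> t" for t
  proof -
    have eq: "R = {0} \<times> {0..}" by (auto simp: R_def)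
    show "convex R" unfolding eq by (intro convex_Times) auto
    show "closed R" unfolding eq by (intro closed_Times) auto
  qed (auto simp: R_def intro: exI[of _ 0])
  have "A \<noteq> {}" using infeasible by auto
  have "convex hull G \<inter> R \<noteq> {}"
  proof
    assume disj: "convex hull G \<inter> R = {}"
    obtain w \<beta> where w: "\<forall>z\<in>convex hull G. w \<bullet> z < \<beta>" "\<forall>z\<in>R. \<beta> < w \<bullet> z"
      using separating_hyperplane_compact_closed[OF convex_convex_hull _ _ R(1,2) disj]
        assms(1) \<open>A \<noteq> {}\<close> by (auto simp: G_def finite_imp_compact_convex_hull)
    obtain y s where ys: "w = (y, s)" by (cases w)
    have neg: "y \<bullet> a + s * b a < \<beta>" if "a \<in> A" for a
      using w(1) hull_inc[of "(a, b a)" G convex] that by (auto simp: G_def ys)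
    have pos: "\<beta> < s * t" if "0 \<le> t" for t
      using w(2)[rule_format, of "(0, t)"] R(4) that by (simp add: ys)
    have "\<beta> < 0" using pos[of 0] by simp
    have "0 \<le> s"
    proof (rule ccontr)
      assume "\<not> 0 \<le> s"
      then have "0 \<le> \<beta> / s" using \<open>\<beta> < 0\<close> by (simp add: divide_nonpos_nonpos)
      from pos[OF this] \<open>\<not> 0 \<le> s\<close> show False by simp
    qed
    (* A vertical hyperplane (s = 0) gives a \<bullet> y < \<beta> < 0 on A, so large negative multiples of y satisfy
       any bounds; otherwise scaling y by - 1 / s gives a solution. *)
    show False
    proof (cases "s = 0")
      case True
      define M where "M = Max ((\<lambda>a. \<bar>b a\<bar>) ` A)"
      have M: "\<bar>b a\<bar> \<le> M" if "a \<in> A" for a unfolding M_def using assms(1) that by simp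
      have "b a \<le> a \<bullet> ((M / \<beta>) *\<^sub>R y)" if "a \<in> A" for a
      proof -
        have "y \<bullet> a < \<beta>" using neg[OF that] True by simp
        moreover have "0 \<le> M" using M[OF that] by linarith
        ultimately have "(M / \<beta>) * \<beta> \<le> (M / \<beta>) * (y \<bullet> a)"
          using \<open>\<beta> < 0\<close> by (intro mult_left_mono_neg) (auto simp: divide_nonneg_neg)
        then show ?thesis using M[OF that] \<open>\<beta> < 0\<close> by (simp add: inner_commute)
      qed
      then show False using infeasible by blast
    next
      case False
      with \<open>0 \<le> s\<close> have "s > 0" by simp
      have "b a \<le> a \<bullet> ((- 1 / s) *\<^sub>R y)" if "a \<in> A" for a
        using neg[OF that] \<open>\<beta> < 0\<close> \<open>s > 0\<close> by (simp add: inner_commute field_simps)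
      then show False using infeasible by blast
    qed
  qed
  then obtain t where t: "(0, t) \<in> convex hull G" "0 \<le> t"
    by (auto simp: R_def)
  obtain T u where T: "finite T" "T \<subseteq> G" "card T \<le> DIM('a \<times> real) + 1" "\<forall>x\<in>T. 0 \<le> u x"
    "sum u T = 1" "(\<Sum>v\<in>T. u v *\<^sub>R v) = (0, t)"
    using t(1) unfolding convex_hull_caratheodory by blast
  define S where "S = fst ` T"
  have snd: "z = (fst z, b (fst z))" if "z \<in> T" for z using that T(2) by (auto simp: G_def)
  have inj: "inj_on fst T" by (rule inj_onI) (metis snd)
  define l where "l a = u (a, b a)" for a
  have sum_S: "sum f S = (\<Sum>z\<in>T. f (fst z))" for f :: "'a \<Rightarrow> 'c::comm_monoid_add"
    unfolding S_def using inj by (simp add: sum.reindex o_def)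
  have l: "l (fst z) = u z" if "z \<in> T" for z using snd[OF that] by (simp add: l_def)
  show ?thesis
  proof (rule that)
    show "S \<subseteq> A" using T(2) by (auto simp: S_def G_def)
    show "card S \<le> DIM('a) + 2" using T(3) inj by (simp add: S_def card_image)
    show "\<And>a. a \<in> S \<Longrightarrow> 0 \<le> l a" using T(4) l by (auto simp: S_def)
    show "sum l S = 1" using T(5) l by (simp add: sum_S)
    have "(\<Sum>a\<in>S. l a *\<^sub>R a) = (\<Sum>z\<in>T. fst (u z *\<^sub>R z))"
      using l by (simp add: sum_S)
    also have "\<dots> = fst (\<Sum>z\<in>T. u z *\<^sub>R z)" by (simp add: fst_sum)
    finally show "(\<Sum>a\<in>S. l a *\<^sub>R a) = 0" using T(6) by simp
    have "l (fst z) * b (fst z) = snd (u z *\<^sub>R z)" if "z \<in> T" for z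
      using l[OF that] snd[OF that] by (simp add: prod_eq_iff)
    then have "(\<Sum>a\<in>S. l a * b a) = (\<Sum>z\<in>T. snd (u z *\<^sub>R z))" by (simp add: sum_S)
    also have "\<dots> = snd (\<Sum>z\<in>T. u z *\<^sub>R z)" by (simp add: snd_sum)
    finally show "0 \<le> (\<Sum>a\<in>S. l a * b a)" using T(6) t(2) by simp
  qed
qed

text \<open>
  The positive sum says that the half-spaces of the Fine interior for the finitely many normals in
  \<open>A\<close> already have no common point: a common point would make the vanishing combination of the
  \<open>a \<bullet> y\<close> positive.
\<close>
definition hollowness_certificate ::
    "(real ^ 'n::finite) set \<Rightarrow> (real ^ 'n) set \<Rightarrow> (real ^ 'n \<Rightarrow> real) \<Rightarrow> bool" where
  "hollowness_certificate P A l \<longleftrightarrow>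
     finite A \<and> A \<subseteq> integer_lattice - {0} \<and> card A \<le> CARD('n) + 2 \<and> (\<forall>a\<in>A. 0 \<le> l a) \<and>
     (\<Sum>a\<in>A. l a *\<^sub>R a) = 0 \<and> 0 < (\<Sum>a\<in>A. l a * (Min_on P a + 1))"

text \<open>
  The half-spaces for the vectors \<open>\<plusminus>e\<^sub>i\<close> cut out a compact box, so a finite part of the empty
  intersection is already empty.  Relaxing every inequality by \<open>1 / (m + 1)\<close>, for all \<open>m\<close>, keeps
  the whole intersection unchanged and leaves a finite subsystem that is infeasible with some slack;
  this slack makes the certificate's inequality strict.
\<close>
lemma F_hollow_imp_certificate:
  fixes P :: "(real ^ 'n::finite) set"
  assumes hollow: "F_hollow UNIV P"
  obtains A l where "hollowness_certificate P A l"
proof -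
  define h :: "real ^ 'n \<Rightarrow> nat \<Rightarrow> real" where "h a m = Min_on P a + 1 - 1 / (m + 1)" for a m
  define U where "U = (\<lambda>i :: 'n. axis i (1::real)) ` UNIV \<union> (\<lambda>i. axis i (- 1)) ` UNIV"
  have "axis i x \<in> integer_lattice" if "x \<in> \<int>" for i :: 'n and x :: real
    using that by (simp add: integer_lattice_iff axis_def)
  then have U: "finite U" "U \<subseteq> integer_lattice - {0}"
    by (auto simp: U_def axis_eq_0_iff)
  define K where "K = cbox (\<chi> i. Min_on P (axis i 1)) (\<chi> i. - Min_on P (axis i (- 1)))"
  define H where "H = (\<lambda>(a, m). {y. h a m \<le> a \<bullet> y})"
  have "closed (H x)" for x
    by (cases x) (simp add: H_def closed_halfspace_ge inner_commute)
  define I where "I = (integer_lattice - {0 :: real ^ 'n}) \<times> (UNIV :: nat set)"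
  have "K \<inter> \<Inter> (H ` I) = {}"
  proof (rule ccontr)
    assume "K \<inter> \<Inter> (H ` I) \<noteq> {}"
    then obtain y where y: "\<And>a m. a \<in> integer_lattice - {0} \<Longrightarrow> h a m \<le> a \<bullet> y"
      by (auto simp: I_def H_def)
    have "Min_on P a + 1 \<le> a \<bullet> y" if "a \<in> integer_lattice - {0}" for a
    proof (rule field_le_epsilon)
      fix e :: real assume "e > 0"
      then obtain m :: nat where "1 / (m + 1) < e"
        using reals_Archimedean[of e] by (auto simp: inverse_eq_divide add.commute)
      with y[OF that, of m] show "Min_on P a + 1 \<le> a \<bullet> y + e" by (simp add: h_def add.commute)
    qed
    then show False using hollow by (auto simp: F_hollow_def fine_interior_def coord_space_def)
  qed
  moreover have "compact K" by (simp add: K_def)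
  ultimately obtain J where J: "finite J" "J \<subseteq> I" "K \<inter> \<Inter> (H ` J) = {}"
    using compact_imp_fip_image[of K I H] \<open>\<And>x. closed (H x)\<close> by metis
  define M where "M = Max (insert 0 (snd ` J))"
  have M: "m \<le> M" if "(a, m) \<in> J" for a m
    unfolding M_def using J(1) that by (intro Max_ge) (auto intro: rev_image_eqI)
  have infeasible: "\<nexists>y. \<forall>a\<in>U \<union> fst ` J. h a M \<le> a \<bullet> y"
  proof
    assume "\<exists>y. \<forall>a\<in>U \<union> fst ` J. h a M \<le> a \<bullet> y"
    then obtain y where y: "\<And>a. a \<in> U \<union> fst ` J \<Longrightarrow> h a M \<le> a \<bullet> y" by blast
    have "1 / (real M + 1) \<le> 1" by simp
    then have hM: "Min_on P a \<le> h a M" for a by (simp add: h_def)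
    have "Min_on P (axis i 1) \<le> y $ i \<and> y $ i \<le> - Min_on P (axis i (- 1))" for i
    proof -
      have "h (axis i 1) M \<le> axis i 1 \<bullet> y" "h (axis i (- 1)) M \<le> axis i (- 1) \<bullet> y"
        by (auto intro!: y simp: U_def)
      with hM[of "axis i 1"] hM[of "axis i (- 1)"] show ?thesis
        by (auto simp: inner_axis' )
    qed
    then have "y \<in> K" by (simp add: K_def mem_box_cart)
    moreover have "y \<in> H x" if "x \<in> J" for x
    proof -
      obtain a m where x: "x = (a, m)" by (cases x)
      have "h a m \<le> h a M" using M that x by (auto simp: h_def intro!: divide_left_mono)
      moreover have "h a M \<le> a \<bullet> y" using y[of a] that x by (metis UnI2 fst_conv image_eqI)
      ultimately show ?thesis by (simp add: H_def x)
    qed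
    ultimately show False using J(3) by blast
  qed
  obtain A l where A: "A \<subseteq> U \<union> fst ` J" "card A \<le> CARD('n) + 2" "\<And>a. a \<in> A \<Longrightarrow> 0 \<le> l a"
    "sum l A = 1" "(\<Sum>a\<in>A. l a *\<^sub>R a) = 0" "0 \<le> (\<Sum>a\<in>A. l a * h a M)"
    by (rule farkas_certificate[OF _ infeasible]) (use U(1) J(1) in auto)
  have "finite A" using A(1) U(1) J(1) by (meson finite_UnI finite_imageI finite_subset)
  have "(\<Sum>a\<in>A. l a * h a M) = (\<Sum>a\<in>A. l a * (Min_on P a + 1)) - sum l A * (1 / (real M + 1))"
    by (simp add: h_def algebra_simps sum.distrib sum_subtractf sum_divide_distrib sum_distrib_left)
  moreover have "1 / (real M + 1) > 0" by simp
  ultimately have "0 < (\<Sum>a\<in>A. l a * (Min_on P a + 1))" using A(4,6) by (simp only: mult_1_left)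
  moreover have "fst ` J \<subseteq> integer_lattice - {0}" using J(2) by (auto simp: I_def)
  then have "A \<subseteq> integer_lattice - {0}" using A(1) U(2) by blast
  ultimately show ?thesis using that A \<open>finite A\<close> unfolding hollowness_certificate_def by blast
qed

section \<open>Bounding the widths along a certificate\<close>

text \<open>
  Put \<open>a = (\<Sum>b\<in>B. l b *\<^sub>R b)\<close> and let \<open>s\<close> be the total weight of \<open>A - B\<close>.  As the weighted sum over
  \<open>A\<close> vanishes, \<open>- a\<close> is the combination over \<open>A - B\<close>; since \<open>y\<close> satisfies the constraints in \<open>B\<close>,
  the certificate forces the excess of \<open>y\<close> along \<open>- a\<close> below \<open>s\<close>.  The hypothesis on \<open>\<delta>\<close> turns
  this into a bound \<open>s / \<delta>\<close> for the width along \<open>a\<close>.  So the weighted sum over \<open>A - B\<close> of the nonnegative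
  numbers \<open>b \<bullet> v - Min_on P b\<close> is at most \<open>s * (1 + 1 / \<delta>)\<close> for all \<open>v \<in> P\<close>, and a normal of largest
  weight, which is at least \<open>s / card (A - B)\<close>, has bounded width.
\<close>
lemma next_width_bound:
  fixes P :: "(real ^ 'n::finite) set"
  assumes P: "compact P" "P \<noteq> {}"
    and cert: "hollowness_certificate P A l"
    and B: "B \<subseteq> A"
    and y: "\<And>b. b \<in> B \<Longrightarrow> Min_on P b + 1 \<le> b \<bullet> y"
    and \<delta>: "\<delta> > 0"
    and ratio: "\<And>a. a \<in> span B \<Longrightarrow> \<delta> * width_on P a \<le> a \<bullet> y - Min_on P a"
  obtains c where "c \<in> A - B" "width_on P c \<le> (CARD('n) + 2) * (1 + 1 / \<delta>)"
proof -
  from cert have A: "finite A" "card A \<le> CARD('n) + 2" and l: "\<And>a. a \<in> A \<Longrightarrow> 0 \<le> l a"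
    and l0: "(\<Sum>a\<in>A. l a *\<^sub>R a) = 0" and lpos: "0 < (\<Sum>a\<in>A. l a * (Min_on P a + 1))"
    by (auto simp: hollowness_certificate_def)
  define R where "R = A - B"
  have R: "finite R" "R \<subseteq> A" "card R \<le> CARD('n) + 2"
    using A card_mono[of A R] by (auto simp: R_def)
  have split: "sum f A = sum f B + sum f R" for f :: "real ^ 'n \<Rightarrow> 'c::comm_monoid_add"
    using sum.subset_diff[OF B A(1), of f] by (simp add: R_def add.commute)
  define a where "a = (\<Sum>b\<in>B. l b *\<^sub>R b)"
  have aR: "- a = (\<Sum>b\<in>R. l b *\<^sub>R b)"
    using l0 unfolding split a_def by (rule minus_unique)
  have "a \<in> span B" unfolding a_def by (intro span_sum span_scale span_base)
  define s where "s = sum l R"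
  define m where "m = (\<Sum>b\<in>R. l b * Min_on P b)"
  have ay: "(\<Sum>b\<in>B. l b * (Min_on P b + 1)) \<le> a \<bullet> y"
    unfolding a_def inner_sum_left inner_scaleR_left
    using y l B by (intro sum_mono mult_left_mono) auto
  have "- m - s < (\<Sum>b\<in>B. l b * (Min_on P b + 1))"
    using lpos unfolding split m_def s_def by (simp add: algebra_simps sum.distrib)
  with ay have 1: "- a \<bullet> y - m < s" by simp
  have "m \<le> Min_on P (- a)"
    unfolding m_def aR using P R l by (intro Min_on_sum) auto
  define E where "E = - a \<bullet> y - Min_on P (- a)"
  have E: "E < s" using 1 \<open>m \<le> Min_on P (- a)\<close> by (simp add: E_def)
  have wE: "\<delta> * width_on P (- a) \<le> E"
    using ratio[of "- a"] \<open>a \<in> span B\<close> by (simp add: span_neg E_def)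
  obtain v0 where "v0 \<in> P" using P(2) by blast
  then have w0: "0 \<le> width_on P (- a)" using inner_le_width_on[OF P(1), of v0 v0 "- a"] by simp
  with \<delta> have "0 \<le> \<delta> * width_on P (- a)" by simp
  with wE E have s: "0 < s" and "0 \<le> E" by linarith+
  have "a \<bullet> y - Min_on P a = width_on P (- a) - E" by (simp add: width_on_def E_def)
  also have "\<dots> \<le> width_on P (- a)" using \<open>0 \<le> E\<close> by simp
  also have "\<dots> \<le> E / \<delta>" using wE \<delta> by (simp add: field_simps)
  also have "\<dots> \<le> s / \<delta>" using E \<delta> by (simp add: divide_right_mono)
  finally have exc: "a \<bullet> y - Min_on P a \<le> s / \<delta>" .
  have "R \<noteq> {}" using s by (auto simp: s_def)
  then have "Max (l ` R) \<in> l ` R" using R(1) by (intro Max_in) auto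
  then obtain c where "c \<in> R" "l c = Max (l ` R)" by auto
  then have c: "c \<in> R" "\<And>b. b \<in> R \<Longrightarrow> l b \<le> l c" using R(1) by auto
  have "s \<le> card R * l c" unfolding s_def using c(2) by (intro sum_bounded_above) auto
  also have "\<dots> \<le> (CARD('n) + 2) * l c"
    using R(3) l c(1) R(2) by (intro mult_right_mono) auto
  finally have sc: "s \<le> (CARD('n) + 2) * l c" .
  with s have lc: "l c > 0" by (smt (verit, ccfv_threshold) mult_nonneg_nonpos of_nat_0_le_iff)
  have "width_on P c \<le> (CARD('n) + 2) * (1 + 1 / \<delta>)"
  proof (rule width_on_le[OF P(2)])
    fix v assume v: "v \<in> P"
    have "l c * (c \<bullet> v - Min_on P c) \<le> (\<Sum>b\<in>R. l b * (b \<bullet> v - Min_on P b))"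
      using l R c(1) Min_on_le[OF P(1) v] by (intro member_le_sum) auto
    also have "\<dots> = - a \<bullet> v - m"
      unfolding aR m_def inner_sum_left by (simp add: algebra_simps sum_subtractf)
    also have "\<dots> \<le> s + (a \<bullet> y - a \<bullet> v)" using 1 by simp
    also have "\<dots> \<le> s + s / \<delta>" using exc Min_on_le[OF P(1) v, of a] by simp
    also have "\<dots> = s * (1 + 1 / \<delta>)" by (simp add: algebra_simps)
    also have "\<dots> \<le> (CARD('n) + 2) * l c * (1 + 1 / \<delta>)"
      using sc \<delta> by (intro mult_right_mono) auto
    finally have "l c * (c \<bullet> v - Min_on P c) \<le> l c * ((CARD('n) + 2) * (1 + 1 / \<delta>))"
      by (simp add: ac_simps)
    then show "c \<bullet> v - Min_on P c \<le> (CARD('n) + 2) * (1 + 1 / \<delta>)" using lc by simp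
  qed
  with c(1) that show ?thesis by (simp add: R_def)
qed

lemma sporadic_imp_compact:
  assumes "sporadic_F_hollow P" shows "compact P" "P \<noteq> {}"
proof -
  have "lattice_polytope UNIV P" "aff_dim P = int (CARD('a))"
    using assms by (auto simp: sporadic_F_hollow_def full_dim_lattice_polytope_def)
  then show "compact P" "P \<noteq> {}"
    by (auto simp: lattice_polytope_def polytope_imp_compact)
qed

text \<open>
  Membership in the Fine interior can be met whenever only the integral normals from a proper
  subspace are taken into account.  The absence of F-hollow lattice projections enters the width bounds
  only through this property.
\<close>
definition relatively_nonhollow :: "(real ^ 'n::finite) set \<Rightarrow> bool" where
  "relatively_nonhollow P \<longleftrightarrow> (\<forall>B \<subseteq> integer_lattice. span B \<noteq> UNIV \<longrightarrow>
     (\<exists>y. \<forall>z \<in> integer_lattice \<inter> span B - {0}. Min_on P z + 1 \<le> z \<bullet> y))"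

text \<open>
  As long as the normals of bounded width do not span the whole space, relative nonhollowness supplies
  a point \<open>y\<close> satisfying the Fine-interior inequalities in their span, and one more normal of the
  certificate acquires bounded width.  The constant may grow with \<open>j\<close> but is the same for all \<open>P\<close>.
\<close>
lemma bounded_widths_on_subset:
  "\<exists>D\<ge>1. \<forall>(P :: (real ^ 'n::finite) set) A l.
     compact P \<and> P \<noteq> {} \<and> relatively_nonhollow P \<and> hollowness_certificate P A l \<longrightarrow>
     (\<exists>B\<subseteq>A. (\<forall>b\<in>B. width_on P b \<le> D) \<and> (span B = UNIV \<or> j \<le> card B))"
proof (induction j)
  case 0
  have "\<exists>B\<subseteq>A. (\<forall>b\<in>B. width_on P b \<le> 1) \<and> (span B = UNIV \<or> 0 \<le> card B)" 
    for P A :: "(real ^ 'n) set" by (intro exI[of _ "{}"]) auto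
  then show ?case by (intro exI[of _ 1]) auto
next
  case (Suc j)
  then obtain D where D: "D \<ge> 1" and IH: "\<forall>(P :: (real ^ 'n) set) A l.
     compact P \<and> P \<noteq> {} \<and> relatively_nonhollow P \<and> hollowness_certificate P A l \<longrightarrow>
     (\<exists>B\<subseteq>A. (\<forall>b\<in>B. width_on P b \<le> D) \<and> (span B = UNIV \<or> j \<le> card B))"
    by (elim exE conjE)
  have step: "\<And>(P :: (real ^ 'n) set) A l. \<lbrakk>compact P; P \<noteq> {}; relatively_nonhollow P;
      hollowness_certificate P A l\<rbrakk> \<Longrightarrow>
      \<exists>B\<subseteq>A. (\<forall>b\<in>B. width_on P b \<le> D) \<and> (span B = UNIV \<or> j \<le> card B)"
    by (intro IH[rule_format]) auto
  let ?N = "CARD('n) + 2"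
  have N0: "0 < ?N" by simp
  obtain \<delta> where \<delta>: "\<delta> > 0"
    "\<forall>g (C :: (real ^ 'n) set) a.
       sublinear g \<and> finite C \<and> card C \<le> ?N \<and> independent C \<and> C \<subseteq> integer_lattice \<and>
       (\<forall>z \<in> integer_lattice \<inter> span C - {0}. 1 \<le> g z) \<and> (\<forall>c\<in>C. g c + g (- c) \<le> D) \<and> a \<in> span C
       \<longrightarrow> \<delta> * (g a + g (- a)) \<le> g a"
    using sublinear_lower_bound[OF N0 D, where 'n='n] by (elim exE conjE)
  define D' where "D' = max D (?N * (1 + 1 / \<delta>))"
  show ?case
  proof (intro exI[of _ D'] conjI allI impI)
    show "1 \<le> D'" using D by (simp add: D'_def)
    fix P :: "(real ^ 'n) set" and A l
    assume "compact P \<and> P \<noteq> {} \<and> relatively_nonhollow P \<and> hollowness_certificate P A l"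
    then have P: "compact P" "P \<noteq> {}" and nh: "relatively_nonhollow P"
      and cert: "hollowness_certificate P A l" by auto
    obtain B where B: "B \<subseteq> A" "\<forall>b\<in>B. width_on P b \<le> D" "span B = UNIV \<or> j \<le> card B"
      using step[OF P nh cert] by blast
    have A: "finite A" "card A \<le> ?N" "A \<subseteq> integer_lattice - {0}"
      using cert by (auto simp: hollowness_certificate_def)
    show "\<exists>B\<subseteq>A. (\<forall>b\<in>B. width_on P b \<le> D') \<and> (span B = UNIV \<or> Suc j \<le> card B)"
    proof (cases "span B = UNIV")
      case True
      with B show ?thesis by (intro exI[of _ B]) (auto simp: D'_def)
    next
      case False
      with nh A(3) B(1) obtain y
        where y: "\<And>z. \<lbrakk>z \<in> integer_lattice; z \<in> span B; z \<noteq> 0\<rbrakk> \<Longrightarrow> Min_on P z + 1 \<le> z \<bullet> y"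
        unfolding relatively_nonhollow_def by (elim allE[of _ B]) blast
      obtain C where C: "C \<subseteq> B" "independent C" "B \<subseteq> span C"
        using maximal_independent_subset by blast
      have spanC: "span C = span B"
        using C by (meson span_minimal span_mono subset_antisym subspace_span)
      have "\<delta> * width_on P a \<le> a \<bullet> y - Min_on P a" if "a \<in> span B" for a
      proof -
        have "\<delta> * ((a \<bullet> y - Min_on P a) + (- a \<bullet> y - Min_on P (- a))) \<le> a \<bullet> y - Min_on P a"
        proof (rule \<delta>(2)[rule_format, of _ C], intro conjI ballI)
          show "sublinear (\<lambda>a. a \<bullet> y - Min_on P a)" by (rule sublinear_excess[OF P])
          show "finite C" "card C \<le> ?N"
            using C(1) B(1) A(1,2) by (meson finite_subset card_mono order_trans)+
          show "independent C" by fact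
          show "C \<subseteq> integer_lattice" using C(1) B(1) A(3) by blast
          show "1 \<le> z \<bullet> y - Min_on P z" if "z \<in> integer_lattice \<inter> span C - {0}" for z
            using y[of z] that spanC by simp
          show "c \<bullet> y - Min_on P c + (- c \<bullet> y - Min_on P (- c)) \<le> D" if "c \<in> C" for c
          proof -
            have "width_on P c \<le> D" using that C(1) B(2) by blast
            then show ?thesis by (simp only: width_on_eq_excess[of P c y])
          qed
          show "a \<in> span C" using that spanC by simp
        qed
        then show ?thesis by (simp only: width_on_eq_excess[of P a y])
      qed
      moreover have "Min_on P b + 1 \<le> b \<bullet> y" if "b \<in> B" for b
        using y[of b] that B(1) A(3) by (auto intro: span_base)
      ultimately obtain c where c: "c \<in> A - B" "width_on P c \<le> ?N * (1 + 1 / \<delta>)"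
        using next_width_bound[OF P cert B(1) _ \<delta>(1), of y] by blast
      have "finite B" using A(1) B(1) finite_subset by blast
      with False B c show ?thesis
        by (intro exI[of _ "insert c B"]) (auto simp: D'_def)
    qed
  qed
qed

lemma bounded_widths_on_spanning_set:
  "\<exists>D. \<forall>P :: (real ^ 'n::finite) set.
     compact P \<and> P \<noteq> {} \<and> F_hollow UNIV P \<and> relatively_nonhollow P \<longrightarrow>
     (\<exists>B\<subseteq>integer_lattice. span B = UNIV \<and> (\<forall>b\<in>B. width_on P b \<le> D))"
proof -
  \<comment> \<open>A certificate has at most \<open>CARD('n) + 2\<close> normals, so one more round leaves only the spanning alternative.\<close>
  obtain D where D: "\<forall>(P :: (real ^ 'n) set) A l.
     compact P \<and> P \<noteq> {} \<and> relatively_nonhollow P \<and> hollowness_certificate P A l \<longrightarrow>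
     (\<exists>B\<subseteq>A. (\<forall>b\<in>B. width_on P b \<le> D) \<and> (span B = UNIV \<or> CARD('n) + 3 \<le> card B))"
    using bounded_widths_on_subset[of "CARD('n) + 3", where 'n='n] by (elim exE conjE)
  show ?thesis
  proof (rule exI[of _ D], intro allI impI)
    fix P :: "(real ^ 'n) set"
    assume "compact P \<and> P \<noteq> {} \<and> F_hollow UNIV P \<and> relatively_nonhollow P"
    then have P: "compact P" "P \<noteq> {}" "F_hollow UNIV P" "relatively_nonhollow P" by auto
    obtain A l where cert: "hollowness_certificate P A l"
      using F_hollow_imp_certificate[OF P(3)] .
    then have A: "finite A" "card A \<le> CARD('n) + 2" "A \<subseteq> integer_lattice"
      by (auto simp: hollowness_certificate_def)
    have "\<exists>B\<subseteq>A. (\<forall>b\<in>B. width_on P b \<le> D) \<and> (span B = UNIV \<or> CARD('n) + 3 \<le> card B)"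
      using D[rule_format, of P A l] P cert by simp
    then obtain B where B: "B \<subseteq> A" "\<forall>b\<in>B. width_on P b \<le> D"
      "span B = UNIV \<or> CARD('n) + 3 \<le> card B" by blast
    with A card_mono[OF A(1) B(1)]
    show "\<exists>B\<subseteq>integer_lattice. span B = UNIV \<and> (\<forall>b\<in>B. width_on P b \<le> D)"
      by (intro exI[of _ B]) auto
  qed
qed

section \<open>Integral linear algebra\<close>

lemma det_in_Ints:
  fixes A :: "real ^ 'n::finite ^ 'n"
  assumes "\<And>i. A $ i \<in> integer_lattice" shows "det A \<in> \<int>"
  using assms unfolding det_def
  by (intro Ints_sum Ints_mult Ints_prod) (auto simp: integer_lattice_iff)

text \<open>
  By Cramer's rule the solution has determinants of integral matrices as coordinates.
\<close>
lemma integral_solution_det_multiple: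
  fixes A :: "real ^ 'n::finite ^ 'n"
  assumes A: "\<And>i. A $ i \<in> integer_lattice" and det: "det A \<noteq> 0" and b: "b \<in> integer_lattice"
  obtains x where "x \<in> integer_lattice" "A *v x = det A *\<^sub>R b"
proof
  let ?A = "\<lambda>k. (\<chi> i j. if j = k then b $ i else A $ i $ j) :: real ^ 'n ^ 'n"
  define x :: "real ^ 'n" where "x = (\<chi> k. det (?A k))"
  show "x \<in> integer_lattice"
    unfolding integer_lattice_iff x_def using A b
    by (auto intro!: det_in_Ints simp: integer_lattice_iff)
  have "A *v ((1 / det A) *\<^sub>R x) = b"
    using cramer[OF det, of "(1 / det A) *\<^sub>R x" b] by (simp add: x_def vec_eq_iff)
  then have "(1 / det A) *\<^sub>R (A *v x) = b" by (simp add: matrix_vector_mult_scaleR)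
  then show "A *v x = det A *\<^sub>R b" using det by auto
qed

lemma basis_matrix:
  fixes T :: "(real ^ 'n::finite) set"
  assumes T: "independent T" "span T = UNIV"
  obtains h :: "'n \<Rightarrow> real ^ 'n" where "bij_betw h UNIV T" "det (\<chi> i. h i) \<noteq> 0"
proof -
  have "card T = CARD('n)"
    using dim_eq_card[OF _ T(1), of UNIV] T(2) by (simp add: dim_UNIV)
  moreover have "finite T" using T(1) by (rule finiteI_independent)
  ultimately obtain h where h: "bij_betw h (UNIV :: 'n set) T"
    using finite_same_card_bij[of "UNIV :: 'n set" T] by auto
  have "rows (\<chi> i. h i) = T" using h by (auto simp: rows_def row_def bij_betw_def vec_lambda_eta)
  then have "det (\<chi> i. h i) \<noteq> 0"
    using T(2) matrix_left_invertible_span_rows[of "\<chi> i. h i"]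
      invertible_left_inverse[of "\<chi> i. h i"] invertible_det_nz[of "\<chi> i. h i"] by simp
  with h that show ?thesis by blast
qed

text \<open>
  Complete a basis of \<open>span B\<close> chosen from \<open>B\<close> by unit vectors to a basis of the whole space and solve
  integrally for the vector that is orthogonal to all members except one of the added ones.
\<close>
lemma integral_orthogonal_vector:
  fixes B :: "(real ^ 'n::finite) set"
  assumes B: "B \<subseteq> integer_lattice" "span B \<noteq> UNIV"
  obtains x where "x \<in> integer_lattice" "x \<noteq> 0" "\<And>b. b \<in> span B \<Longrightarrow> b \<bullet> x = 0"
proof -
  obtain C where C: "C \<subseteq> B" "independent C" "B \<subseteq> span C"
    using maximal_independent_subset by blast
  obtain T where T: "C \<subseteq> T" "T \<subseteq> B \<union> range (\<lambda>i. axis i 1)" "independent T"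
      "B \<union> range (\<lambda>i. axis i 1) \<subseteq> span T"
    using maximal_independent_subset_extend[of C "B \<union> range (\<lambda>i. axis i (1::real))"] C by blast
  have "(UNIV :: (real ^ 'n) set) = span Basis" by simp
  also have "\<dots> \<subseteq> span T"
    using T(4) by (intro span_minimal) (auto simp: Basis_vec_def)
  finally have spanT: "span T = UNIV" by auto
  have "T \<noteq> C" using spanT B(2) C by (metis span_minimal span_mono subset_antisym subspace_span)
  then obtain w where w: "w \<in> T" "w \<notin> C" using T(1) by blast
  obtain h where h: "bij_betw h (UNIV :: 'n set) T" and det: "det (\<chi> i. h i) \<noteq> 0"
    using basis_matrix[OF T(3) spanT] by blast
  define A :: "real ^ 'n ^ 'n" where "A = (\<chi> i. h i)"
  have det: "det A \<noteq> 0" using det by (simp add: A_def)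
  have "T \<subseteq> integer_lattice" using T(2) B(1) integer_lattice_axis by blast
  then have "A $ i \<in> integer_lattice" for i
    using h by (auto simp: A_def bij_betw_def)
  moreover obtain k where k: "h k = w" using h w(1) by (auto simp: bij_betw_def)
  ultimately obtain x where x: "x \<in> integer_lattice" "A *v x = det A *\<^sub>R axis k 1"
    using integral_solution_det_multiple[OF _ det] integer_lattice_axis by metis
  show ?thesis
  proof (rule that[OF x(1)])
    show "x \<noteq> 0" using x(2) det by (auto simp: axis_eq_0_iff)
    have 0: "x \<bullet> c = 0" if c: "c \<in> C" for c
    proof -
      obtain i where i: "h i = c" using h c T(1) by (auto simp: bij_betw_def)
      with c w(2) k have "i \<noteq> k" by auto
      have "c \<bullet> x = (A *v x) $ i" by (simp add: matrix_vector_mul_component A_def i)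
      also have "\<dots> = 0" unfolding x(2) using \<open>i \<noteq> k\<close> by (simp add: axis_def)
      finally show ?thesis by (simp add: inner_commute)
    qed
    show "b \<bullet> x = 0" if "b \<in> span B" for b
    proof -
      have "b \<in> span C" using that C(3) by (metis span_minimal subspace_span subsetD)
      then have "orthogonal x b"
        by (rule orthogonal_to_span) (use 0 in \<open>auto simp: orthogonal_def\<close>)
      then show ?thesis by (simp add: orthogonal_def inner_commute)
    qed
  qed
qed

definition unimodular :: "(real ^ 'n::finite \<Rightarrow> real ^ 'n) \<Rightarrow> bool" where
  "unimodular U \<longleftrightarrow> linear U \<and> bij U \<and> U ` integer_lattice = integer_lattice"

lemma unimodular_shear:
  fixes i j :: "'n::finite"
  assumes "i \<noteq> j" "s \<in> \<int>"
  shows "unimodular (\<lambda>z :: real ^ 'n. z - (s * z $ j) *\<^sub>R axis i 1)" (is "unimodular ?S")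
proof -
  let ?T = "\<lambda>z :: real ^ 'n. z + (s * z $ j) *\<^sub>R axis i 1"
  have inv: "?S (?T z) = z" "?T (?S z) = z" for z
    using assms(1) by (auto simp: axis_def algebra_simps)
  have "(s * z $ j) *\<^sub>R axis i 1 \<in> integer_lattice" if "z \<in> integer_lattice" for z :: "real ^ 'n"
    using that assms(2) by (intro integer_lattice_scaleR integer_lattice_axis) (simp add: integer_lattice_iff)
  then have int: "?S z \<in> integer_lattice" "?T z \<in> integer_lattice" if "z \<in> integer_lattice" for z
    using that by (auto intro: integer_lattice_add integer_lattice_diff)
  have "linear ?S"
    by (auto intro!: linearI simp: algebra_simps)
  moreover have "bij ?S" by (rule bij_betw_byWitness[of _ ?T]) (use inv in auto)
  moreover have "?S ` integer_lattice = integer_lattice"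
  proof (intro subset_antisym subsetI)
    fix z :: "real ^ 'n" assume "z \<in> integer_lattice"
    then show "z \<in> ?S ` integer_lattice"
      by (intro image_eqI[of _ _ "?T z"]) (use int inv in auto)
  qed (use int in auto)
  ultimately show ?thesis unfolding unimodular_def by blast
qed

lemma unimodular_comp: "unimodular U \<Longrightarrow> unimodular V \<Longrightarrow> unimodular (\<lambda>x. U (V x))"
  unfolding unimodular_def
  using linear_compose[of V U] bij_comp[of V U] by (auto simp: o_def image_image[symmetric])

text \<open>
  Euclid's algorithm on the coordinates: subtracting a nonzero coordinate, with suitable sign, from
  another one that is at least as large is a shear and decreases the sum of the absolute values.
\<close>
lemma unimodular_to_axis:
  fixes x :: "real ^ 'n::finite"
  assumes "x \<in> integer_lattice"
  shows "\<exists>U i t. unimodular U \<and> U x = t *\<^sub>R axis i 1"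
  using assms
proof (induction "\<Sum>i\<in>UNIV. nat \<lfloor>\<bar>x $ i\<bar>\<rfloor>" arbitrary: x rule: less_induct)
  case less
  show ?case
  proof (cases "\<exists>i j. i \<noteq> j \<and> x $ i \<noteq> 0 \<and> x $ j \<noteq> 0")
    case True
    then obtain i j where ij: "i \<noteq> j" "x $ j \<noteq> 0" "x $ i \<noteq> 0" "\<bar>x $ j\<bar> \<le> \<bar>x $ i\<bar>"
      by (metis linear)
    define s where "s = sgn (x $ i) * sgn (x $ j)"
    have s: "s \<in> \<int>" unfolding s_def by (simp add: sgn_if)
    define S where "S = (\<lambda>z :: real ^ 'n. z - (s * z $ j) *\<^sub>R axis i 1)"
    have S: "unimodular S" unfolding S_def using unimodular_shear[OF ij(1) s] .
    have Sx: "S x \<in> integer_lattice" using S less.prems unfolding unimodular_def by blast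
    have other: "S x $ k = x $ k" if "k \<noteq> i" for k
      using that by (simp add: S_def axis_def)
    have "\<bar>S x $ i\<bar> = \<bar>x $ i\<bar> - \<bar>x $ j\<bar>"
      using ij by (auto simp: S_def s_def sgn_if abs_if split: if_splits)
    then have "\<bar>S x $ i\<bar> < \<bar>x $ i\<bar>" using ij by simp
    moreover have "\<bar>S x $ i\<bar> \<in> \<int>" "\<bar>x $ i\<bar> \<in> \<int>"
      using Sx less.prems by (simp_all add: integer_lattice_iff)
    ultimately have "nat \<lfloor>\<bar>S x $ i\<bar>\<rfloor> < nat \<lfloor>\<bar>x $ i\<bar>\<rfloor>"
      by (elim Ints_cases) auto
    then have "nat \<lfloor>\<bar>S x $ k\<bar>\<rfloor> \<le> nat \<lfloor>\<bar>x $ k\<bar>\<rfloor>" for k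
      using other[of k] by (cases "k = i") auto
    with \<open>nat \<lfloor>\<bar>S x $ i\<bar>\<rfloor> < nat \<lfloor>\<bar>x $ i\<bar>\<rfloor>\<close>
    have "(\<Sum>k\<in>UNIV. nat \<lfloor>\<bar>S x $ k\<bar>\<rfloor>) < (\<Sum>k\<in>UNIV. nat \<lfloor>\<bar>x $ k\<bar>\<rfloor>)"
      by (intro sum_strict_mono_ex1) auto
    from less.hyps[OF this Sx] obtain U k t where "unimodular U" "U (S x) = t *\<^sub>R axis k 1"
      by blast
    then show ?thesis using unimodular_comp[OF _ S] by blast
  next
    case False
    then obtain i where "\<And>j. j \<noteq> i \<Longrightarrow> x $ j = 0" by metis
    then have "x = (x $ i) *\<^sub>R axis i 1" by (auto simp: vec_eq_iff axis_def)
    moreover have "unimodular (\<lambda>x :: real ^ 'n. x)"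
      by (auto simp: unimodular_def linear_id[unfolded id_def] bij_id[unfolded id_def])
    ultimately show ?thesis by blast
  qed
qed

section \<open>Projections of sporadic polytopes\<close>

lemma lattice_polytope_convex_hull:
  fixes P :: "(real ^ 'n::finite) set"
  assumes "lattice_polytope UNIV P"
  obtains V where "V \<subseteq> integer_lattice" "P = convex hull V"
proof
  let ?V = "{v. v extreme_point_of P}"
  have P: "polytope P" using assms by (simp add: lattice_polytope_def)
  show "?V \<subseteq> integer_lattice" using assms by (auto simp: lattice_polytope_def)
  show "P = convex hull ?V"
    using Krein_Milman_Minkowski[OF polytope_imp_compact[OF P] polytope_imp_convex[OF P]] .
qed

text \<open>
  Let \<open>x\<close> be a nonzero lattice vector orthogonal to \<open>span B\<close>.  After a unimodular change of coordinates
  \<open>U\<close> it points along a coordinate axis \<open>i\<close>, and forgetting that coordinate gives a lattice projection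
  \<open>\<pi>\<close> of \<open>P\<close> of codimension one.  As \<open>P\<close> is sporadic, the image has a point in its Fine interior.
  Every integral vector of \<open>span B\<close> vanishes on \<open>x\<close>, hence comes from an integral normal of the
  image with the same minimum, so that any preimage of this point is as required.  In dimension one
  nothing is left after forgetting the coordinate, but then \<open>span B = {0}\<close>.
\<close>
lemma sporadic_imp_relatively_nonhollow:
  fixes P :: "(real ^ 'n::finite) set"
  assumes sp: "sporadic_F_hollow P" shows "relatively_nonhollow P"
  unfolding relatively_nonhollow_def
proof (intro allI impI)
  fix B :: "(real ^ 'n) set" assume B: "B \<subseteq> integer_lattice" "span B \<noteq> UNIV"
  have P: "lattice_polytope UNIV P" "aff_dim P = int CARD('n)"
    using sp by (auto simp: sporadic_F_hollow_def full_dim_lattice_polytope_def)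
  obtain x where x: "x \<in> integer_lattice" "x \<noteq> 0" "\<And>b. b \<in> span B \<Longrightarrow> b \<bullet> x = 0"
    using integral_orthogonal_vector[OF B] by metis
  obtain U i t where U: "unimodular U" and Ux: "U x = t *\<^sub>R axis i 1"
    using unimodular_to_axis[OF x(1)] by blast
  then have lin: "linear U" and bij: "bij U" and UZ: "U ` integer_lattice = integer_lattice"
    by (auto simp: unimodular_def)
  define V where "V = inv U"
  have VU: "V (U z) = z" "U (V z) = z" for z
    using bij by (auto simp: V_def bij_is_inj bij_is_surj surj_f_inv_f)
  have linV: "linear V"
    unfolding V_def using lin bij by (simp add: bij_is_inj inj_linear_imp_inv_linear)
  have t0: "t \<noteq> 0" using Ux x(2) VU linear_0[OF linV] by (metis scaleR_zero_left)
  define I where "I = - {i}"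
  define \<pi> where "\<pi> y = (\<chi> j. if j = i then 0 else U y $ j)" for y
  have lin\<pi>: "linear \<pi>"
    by (rule linearI) (auto simp: \<pi>_def vec_eq_iff linear_add[OF lin] linear_scale[OF lin])
  have \<pi>_id: "\<pi> (V w) = w" if "w \<in> coord_space I" for w
    using that by (auto simp: \<pi>_def VU coord_space_def I_def vec_eq_iff)
  have range: "range \<pi> = coord_space I"
  proof
    show "range \<pi> \<subseteq> coord_space I" by (auto simp: \<pi>_def coord_space_def I_def)
    show "coord_space I \<subseteq> range \<pi>" using \<pi>_id by (metis rangeI subsetI)
  qed
  have \<pi>Z: "\<pi> ` integer_lattice = coord_lattice I"
  proof
    show "\<pi> ` integer_lattice \<subseteq> coord_lattice I"
    proof
      fix w assume "w \<in> \<pi> ` integer_lattice"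
      then obtain z where z: "z \<in> integer_lattice" "w = \<pi> z" by blast
      then have "U z \<in> integer_lattice" using UZ by blast
      then show "w \<in> coord_lattice I"
        by (auto simp: z(2) \<pi>_def coord_lattice_def coord_space_def I_def)
    qed
    show "coord_lattice I \<subseteq> \<pi> ` integer_lattice"
    proof
      fix w assume w: "w \<in> coord_lattice I"
      then have "w \<in> integer_lattice" "w \<in> coord_space I"
        by (auto simp: coord_lattice_def coord_space_def)
      then have "w \<in> U ` integer_lattice" using UZ by simp
      then show "w \<in> \<pi> ` integer_lattice"
        using \<pi>_id[OF \<open>w \<in> coord_space I\<close>] VU by (metis image_iff)
    qed
  qed
  show "\<exists>y. \<forall>z\<in>integer_lattice \<inter> span B - {0}. Min_on P z + 1 \<le> z \<bullet> y"
  proof (cases "I = {}")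
    case True
    then have U1: "(UNIV :: 'n set) = {i}" by (auto simp: I_def)
    have "z = 0" if "z \<in> span B" for z
    proof -
      have "z $ i * x $ i = 0" using x(3)[OF that] unfolding inner_vec_def U1 by simp
      moreover have "x $ i \<noteq> 0" using x(2) U1 by (metis UNIV_I singletonD vec_eq_iff zero_index)
      ultimately show ?thesis using U1 by (metis UNIV_I mult_eq_0_iff singletonD vec_eq_iff zero_index)
    qed
    then show ?thesis by blast
  next
    case False
    then have card: "1 \<le> card I" "card I < CARD('n)"
      by (auto simp: I_def card_gt_0_iff Suc_le_eq intro!: psubset_card_mono)
    have "lattice_polytope I (\<pi> ` P)"
    proof -
      obtain W where W: "W \<subseteq> integer_lattice" "P = convex hull W"
        using lattice_polytope_convex_hull[OF P(1)] by metis
      have "\<pi> ` P = convex hull (\<pi> ` W)" unfolding W(2) by (rule convex_hull_linear_image[OF lin\<pi>])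
      then have "v \<in> \<pi> ` W" if "v extreme_point_of (\<pi> ` P)" for v
        using that extreme_point_of_convex_hull by metis
      then have "v \<in> coord_lattice I" if "v extreme_point_of (\<pi> ` P)" for v
        using that W(1) \<pi>Z by blast
      then show ?thesis using P(1) range polytope_linear_image[OF lin\<pi>]
        unfolding lattice_polytope_def by blast
    qed
    moreover have "aff_dim (\<pi> ` P) = int (card I)"
    proof -
      have "affine hull P = UNIV" using P(2) aff_dim_eq_full[of P] by simp
      then have "affine hull (\<pi> ` P) = coord_space I"
        using affine_hull_linear_image[of \<pi> P] lin\<pi> range by (simp add: linear_conv_bounded_linear)
      then have "aff_dim (\<pi> ` P) = aff_dim (coord_space I)" by (metis aff_dim_affine_hull)
      also have "\<dots> = int (dim (coord_space I))"
        using range lin\<pi> by (metis aff_dim_subspace linear_subspace_image subspace_UNIV)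
      also have "dim (coord_space I) = card I" unfolding coord_space_def
        using dim_substandard_cart[of I, where ?'a = real] by (simp add: dim_vec_eq)
      finally show ?thesis .
    qed
    moreover have "lattice_projection P I (\<pi> ` P)"
      unfolding lattice_projection_def affine_map_def
      using lin\<pi> range \<pi>Z by (intro exI[of _ \<pi>]) (auto intro!: exI[of _ \<pi>] exI[of _ 0])
    ultimately have "\<not> F_hollow I (\<pi> ` P)"
      using sp card unfolding sporadic_F_hollow_def full_dim_lattice_polytope_def by blast
    then obtain y where y: "\<And>a. a \<in> coord_lattice I - {0} \<Longrightarrow> Min_on (\<pi> ` P) a + 1 \<le> a \<bullet> y"
      and yI: "y \<in> coord_space I"
      unfolding F_hollow_def fine_interior_def by blast
    have "Min_on P z + 1 \<le> z \<bullet> V y" if z: "z \<in> integer_lattice \<inter> span B - {0}" for z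
    proof -
      \<comment> \<open>The functional given by \<open>z\<close>, written in the new coordinates.\<close>
      define a where "a = adjoint V z"
      have a: "a \<bullet> w = z \<bullet> V w" for w
        unfolding a_def using adjoint_works[OF linV, of w z] by (simp add: inner_commute)
      have aj: "a $ j = z \<bullet> V (axis j 1)" for j
        using a[of "axis j 1"] by (simp add: inner_axis)
      have "V (axis j 1) \<in> integer_lattice" for j
        using UZ VU integer_lattice_axis by (metis imageE)
      then have "a $ j \<in> \<int>" for j using z by (auto simp: aj intro: integer_lattice_inner)
      moreover have "a $ i = 0"
      proof -
        have "V (U x) = t *\<^sub>R V (axis i 1)" unfolding Ux by (rule linear_scale[OF linV])
        then have "t * a $ i = z \<bullet> x" by (simp add: aj VU inner_scaleR_right)
        then show ?thesis using x(3)[of z] z t0 by simp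
      qed
      ultimately have "a \<in> coord_lattice I"
        by (auto simp: coord_lattice_def coord_space_def I_def)
      moreover have "a \<noteq> 0" using a[of "U z"] z by (auto simp: VU)
      moreover have "a \<bullet> \<pi> v = z \<bullet> v" for v
      proof -
        have "a \<bullet> \<pi> v = a \<bullet> U v"
          unfolding inner_vec_def using \<open>a $ i = 0\<close> by (intro sum.cong) (auto simp: \<pi>_def)
        then show ?thesis by (simp add: a VU)
      qed
      then have "Min_on (\<pi> ` P) a = Min_on P z" by (simp add: Min_on_def image_image)
      ultimately show ?thesis using y[of a] by (simp add: a)
    qed
    then show ?thesis by blast
  qed
qed

section \<open>Lattices between a sublattice and the integer lattice\<close>

lemma finite_lattice_box: "finite {x \<in> integer_lattice :: (real ^ 'n::finite) set. \<forall>i. \<bar>x $ i\<bar> \<le> D}"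
proof -
  let ?S = "{k \<in> \<int>. \<bar>k\<bar> \<le> D}"
  have "finite ((\<lambda>f. \<chi> i. f i) ` (UNIV \<rightarrow>\<^sub>E ?S) :: (real ^ 'n) set)"
    by (intro finite_imageI finite_PiE finite_abs_int_segment) auto
  moreover have "x \<in> (\<lambda>f. \<chi> i. f i) ` (UNIV \<rightarrow>\<^sub>E ?S)"
    if "x \<in> integer_lattice" "\<forall>i. \<bar>x $ i\<bar> \<le> D" for x :: "real ^ 'n"
    using that by (intro image_eqI[of _ _ "\<lambda>i. x $ i"]) (auto simp: integer_lattice_iff)
  ultimately show ?thesis by (elim finite_subset[rotated]) auto
qed

definition add_subgroup :: "'a::real_vector set \<Rightarrow> bool" where
  "add_subgroup L \<longleftrightarrow> 0 \<in> L \<and> (\<forall>x\<in>L. \<forall>y\<in>L. x - y \<in> L)"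

lemma add_subgroup_add: "add_subgroup L \<Longrightarrow> x \<in> L \<Longrightarrow> y \<in> L \<Longrightarrow> x + y \<in> L"
  unfolding add_subgroup_def by (metis diff_0 diff_minus_eq_add)

lemma add_subgroup_scaleR:
  assumes L: "add_subgroup L" "x \<in> L" and "c \<in> \<int>" shows "c *\<^sub>R x \<in> L"
proof -
  have nat: "of_nat k *\<^sub>R x \<in> L" for k
  proof (induction k)
    case 0 show ?case using L by (simp add: add_subgroup_def)
  next
    case (Suc k)
    then show ?case using add_subgroup_add[OF L Suc] by (simp add: scaleR_add_left)
  qed
  obtain k :: int where k: "c = of_int k" using \<open>c \<in> \<int>\<close> by (elim Ints_cases)
  show ?thesis
  proof (cases "0 \<le> k")
    case True
    then show ?thesis using nat[of "nat k"] by (simp add: k)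
  next
    case False
    then have "0 - of_nat (nat (- k)) *\<^sub>R x \<in> L" using nat L(1) unfolding add_subgroup_def by blast
    with False show ?thesis by (simp add: k)
  qed
qed

lemma add_subgroup_sum:
  assumes "add_subgroup L" "\<And>i. i \<in> S \<Longrightarrow> f i \<in> L" shows "sum f S \<in> L"
  using assms
  by (induction S rule: infinite_finite_induct) (auto simp: add_subgroup_add add_subgroup_def)

text \<open>
  A basis chosen from \<open>V\<close> generates a lattice containing \<open>\<Delta>\<close> times the integer lattice, where \<open>\<Delta>\<close> is
  the absolute value of its determinant.  Hence \<open>L\<close> is determined by its points in a bounded box.
\<close>
lemma finite_intermediate_lattices:
  fixes V :: "(real ^ 'n::finite) set"
  assumes V: "V \<subseteq> integer_lattice" "span V = UNIV"
  shows "finite {L. add_subgroup L \<and> V \<subseteq> L \<and> L \<subseteq> integer_lattice}" (is "finite ?\<L>")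
proof -
  obtain T where T: "T \<subseteq> V" "independent T" "V \<subseteq> span T"
    using maximal_independent_subset by blast
  have spanT: "span T = UNIV" using T(3) V(2) by (metis span_minimal subspace_span top.extremum_uniqueI)
  obtain h where h: "bij_betw h (UNIV :: 'n set) T" and det: "det (\<chi> i. h i) \<noteq> 0"
    using basis_matrix[OF T(2) spanT] by blast
  define A :: "real ^ 'n ^ 'n" where "A = transpose (\<chi> i. h i)"
  have col: "column j A = h j" for j by (simp add: column_def A_def transpose_def vec_lambda_eta)
  have det: "det A \<noteq> 0" using det by (simp add: A_def det_transpose)
  have hV: "h j \<in> V" for j using h T(1) by (auto simp: bij_betw_def)
  then have AZ: "A $ i \<in> integer_lattice" for i
    using V(1) by (auto simp: A_def transpose_def integer_lattice_iff subset_iff)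
  \<comment> \<open>\<open>\<Delta>\<close> times the integer lattice is contained in every \<open>L\<close>, so reducing coordinates modulo \<open>\<Delta>\<close> stays inside \<open>L\<close>.\<close>
  define \<Delta> where "\<Delta> = \<bar>det A\<bar>"
  have \<Delta>: "\<Delta> > 0" "\<Delta> \<in> \<int>" using det det_in_Ints[OF AZ] by (auto simp: \<Delta>_def)
  have mult: "\<Delta> *\<^sub>R b \<in> L" if L: "L \<in> ?\<L>" and b: "b \<in> integer_lattice" for L b
  proof -
    obtain x where x: "x \<in> integer_lattice" "A *v x = det A *\<^sub>R b"
      using integral_solution_det_multiple[OF AZ det b] .
    have "det A *\<^sub>R b = (\<Sum>j\<in>UNIV. x $ j *\<^sub>R h j)"
      using x(2) by (simp add: matrix_mult_sum col vector_scaleR_component scalar_mult_eq_scaleR)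
    also have "\<dots> \<in> L"
      using L hV x(1) by (intro add_subgroup_sum add_subgroup_scaleR) (auto simp: integer_lattice_iff)
    finally have "det A *\<^sub>R b \<in> L" .
    then have "sgn (det A) *\<^sub>R (det A *\<^sub>R b) \<in> L"
      using L by (intro add_subgroup_scaleR[of L "det A *\<^sub>R b"]) (auto simp: sgn_if)
    then show ?thesis by (simp add: \<Delta>_def abs_sgn mult.commute)
  qed
  define Q where "Q = {x \<in> integer_lattice :: (real ^ 'n) set. \<forall>i. \<bar>x $ i\<bar> \<le> \<Delta>}"
  have sub: "L \<subseteq> L'" if L: "L \<in> ?\<L>" and L': "L' \<in> ?\<L>" and eq: "L \<inter> Q = L' \<inter> Q" for L L'
  proof
    fix x assume x: "x \<in> L"
    define z :: "real ^ 'n" where "z = (\<chi> i. of_int \<lfloor>x $ i / \<Delta>\<rfloor>)"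
    define r where "r = x - \<Delta> *\<^sub>R z"
    have z: "z \<in> integer_lattice" by (simp add: z_def integer_lattice_iff)
    have "r \<in> L" using L x mult[OF L z] unfolding r_def add_subgroup_def by auto
    moreover have "\<bar>r $ i\<bar> \<le> \<Delta>" for i
    proof -
      have "r $ i = \<Delta> * frac (x $ i / \<Delta>)"
        using \<Delta>(1) by (simp add: r_def z_def frac_def algebra_simps)
      then show ?thesis
        using \<Delta>(1) frac_ge_0[of "x $ i / \<Delta>"] frac_lt_1[of "x $ i / \<Delta>"]
        by (simp add: abs_mult mult_le_cancel_left1)
    qed
    ultimately have "r \<in> L' \<inter> Q" using L eq by (auto simp: Q_def)
    then have "r + \<Delta> *\<^sub>R z \<in> L'" using L' mult[OF L' z] by (intro add_subgroup_add) auto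
    then show "x \<in> L'" by (simp add: r_def)
  qed
  have "inj_on (\<lambda>L. L \<inter> Q) ?\<L>" 
  proof (rule inj_onI)
    fix L L' assume L: "L \<in> ?\<L>" "L' \<in> ?\<L>" and eq: "L \<inter> Q = L' \<inter> Q"
    show "L = L'" using sub[OF L eq] sub[OF L(2,1) eq[symmetric]] by (rule subset_antisym)
  qed
  moreover have "finite ((\<lambda>L. L \<inter> Q) ` ?\<L>)"
    using finite_lattice_box[of \<Delta>, where 'n='n] by (auto simp: Q_def intro: finite_subset[of _ "Pow Q"])
  ultimately show ?thesis by (rule finite_imageD[rotated])
qed

section \<open>Unimodular equivalence\<close>

lemma unimodular_equivalence_sym:
  assumes "(P, Q) \<in> unimodular_equivalence" shows "(Q, P) \<in> unimodular_equivalence"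
proof -
  obtain \<phi> g c where \<phi>: "bij \<phi>" "\<phi> ` integer_lattice = integer_lattice" "\<phi> ` P = Q"
    and g: "linear g" "\<phi> = (\<lambda>x. g x + c)" and PQ: "lattice_polytope UNIV P" "lattice_polytope UNIV Q"
    using assms unfolding unimodular_equivalence_def affine_map_def by blast
  have g_eq: "g = (\<lambda>y. y - c) \<circ> \<phi>" by (auto simp: g(2))
  have "bij (\<lambda>y :: real ^ 'a. y - c)" by (rule bij_betw_byWitness[of _ "\<lambda>y. y + c"]) auto
  then have "bij g" unfolding g_eq using \<phi>(1) bij_comp by blast
  have inv: "inv \<phi> y = inv g y + (- inv g c)" for y
  proof -
    have lin: "linear (inv g)" using g(1) \<open>bij g\<close> by (simp add: bij_is_inj inj_linear_imp_inv_linear)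
    have "\<phi> (inv g y + (- inv g c)) = y"
      using \<open>bij g\<close> by (simp add: g(2) linear_diff[OF g(1)] bij_is_surj surj_f_inv_f)
    then show ?thesis using \<phi>(1) by (metis bij_inv_eq_iff)
  qed
  have "affine_map (inv \<phi>)"
    unfolding affine_map_def using inv g(1) \<open>bij g\<close>
    by (intro exI[of _ "inv g"] exI[of _ "- inv g c"]) (auto simp: bij_is_inj inj_linear_imp_inv_linear)
  moreover have "inv \<phi> ` integer_lattice = integer_lattice" "inv \<phi> ` Q = P"
    using \<phi> by (metis bij_is_inj image_inv_f_f)+
  ultimately show ?thesis
    using \<phi>(1) PQ bij_imp_bij_inv unfolding unimodular_equivalence_def by blast
qed

lemma unimodular_equivalence_trans:
  assumes "(P, Q) \<in> unimodular_equivalence" "(Q, R) \<in> unimodular_equivalence"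
  shows "(P, R) \<in> unimodular_equivalence"
proof -
  obtain \<phi> g c where \<phi>: "bij \<phi>" "\<phi> ` integer_lattice = integer_lattice" "\<phi> ` P = Q"
    and g: "linear g" "\<phi> = (\<lambda>x. g x + c)" and P: "lattice_polytope UNIV P"
    using assms(1) unfolding unimodular_equivalence_def affine_map_def by blast
  obtain \<psi> h d where \<psi>: "bij \<psi>" "\<psi> ` integer_lattice = integer_lattice" "\<psi> ` Q = R"
    and h: "linear h" "\<psi> = (\<lambda>x. h x + d)" and R: "lattice_polytope UNIV R"
    using assms(2) unfolding unimodular_equivalence_def affine_map_def by blast
  have "affine_map (\<psi> \<circ> \<phi>)"
    unfolding affine_map_def
    by (intro exI[of _ "h \<circ> g"] exI[of _ "h c + d"])
       (auto simp: g h linear_compose linear_add[OF h(1)])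
  moreover have "(\<psi> \<circ> \<phi>) ` integer_lattice = integer_lattice" "(\<psi> \<circ> \<phi>) ` P = R"
    using \<phi>(2,3) \<psi>(2,3) by (metis image_comp)+
  moreover have "bij (\<psi> \<circ> \<phi>)" using \<phi>(1) \<psi>(1) by (rule bij_comp)
  ultimately show ?thesis using P R unfolding unimodular_equivalence_def by blast
qed

section \<open>Finitely many classes of bounded width\<close>

text \<open>
  A linear isomorphism \<open>M\<close> records \<open>P\<close>, up to translation, by the images \<open>V\<close> of its generating
  points together with the image \<open>L\<close> of the integer lattice.  The lattice is needed because \<open>M\<close>, while
  integral in the application below, is in general not unimodular.
\<close>
definition coordinate_model ::
    "(real ^ 'n::finite) set \<Rightarrow> (real ^ 'n) set \<Rightarrow> (real ^ 'n) set \<Rightarrow> bool" where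
  "coordinate_model P V L \<longleftrightarrow> (\<exists>M v W. linear M \<and> bij M \<and> v \<in> integer_lattice \<and>
     P = convex hull W \<and> V = (\<lambda>w. M (w - v)) ` W \<and> L = M ` integer_lattice)"

text \<open>
  If \<open>M\<close> and \<open>N\<close> are the isomorphisms of the two models, then \<open>N\<inverse> \<circ> M\<close>, up to translations by lattice
  vectors, carries \<open>P\<close> to \<open>Q\<close>, and it preserves the integer lattice because both isomorphisms map it
  onto \<open>L\<close>.
\<close>
lemma same_model_imp_equivalent:
  fixes P Q :: "(real ^ 'n::finite) set"
  assumes P: "lattice_polytope UNIV P" "coordinate_model P V L"
    and Q: "lattice_polytope UNIV Q" "coordinate_model Q V L"
  shows "(P, Q) \<in> unimodular_equivalence"
proof -
  obtain M v W where M: "linear M" "bij M" and v: "v \<in> integer_lattice"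
    and PW: "P = convex hull W" "V = (\<lambda>w. M (w - v)) ` W" "L = M ` integer_lattice"
    using P(2) unfolding coordinate_model_def by blast
  obtain N u X where N: "linear N" "bij N" and u: "u \<in> integer_lattice"
    and QX: "Q = convex hull X" "V = (\<lambda>w. N (w - u)) ` X" "L = N ` integer_lattice"
    using Q(2) unfolding coordinate_model_def by blast
  define N' where "N' = inv N"
  have N': "N' (N z) = z" "N (N' z) = z" for z
    using N(2) by (auto simp: N'_def bij_is_inj bij_is_surj surj_f_inv_f)
  have linN': "linear N'" using N by (simp add: N'_def bij_is_inj inj_linear_imp_inv_linear)
  have bijN': "bij N'" using N(2) by (simp add: N'_def bij_imp_bij_inv)
  define g where "g = N' \<circ> M"
  have g: "linear g" "bij g"
    using M linN' bijN' by (auto simp: g_def linear_compose bij_comp)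
  define \<phi> where "\<phi> x = g x + (u - g v)" for x
  have \<phi>: "\<phi> x = u + g (x - v)" for x by (simp add: \<phi>_def linear_diff[OF g(1)])
  have "affine_map \<phi>" unfolding affine_map_def \<phi>_def[abs_def] using g(1) by blast
  moreover have "bij \<phi>"
  proof -
    have "\<phi> = (\<lambda>y. y + (u - g v)) \<circ> g" by (auto simp: \<phi>_def)
    moreover have "bij (\<lambda>y :: real ^ 'n. y + (u - g v))"
      by (rule bij_betw_byWitness[of _ "\<lambda>y. y - (u - g v)"]) auto
    ultimately show ?thesis using g(2) bij_comp by metis
  qed
  moreover have "\<phi> ` integer_lattice = integer_lattice"
  proof -
    have "(\<lambda>x. x - v) ` integer_lattice = integer_lattice"
    proof (intro subset_antisym subsetI)
      fix x :: "real ^ 'n" assume "x \<in> integer_lattice"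
      then show "x \<in> (\<lambda>x. x - v) ` integer_lattice"
        using v by (intro image_eqI[of _ _ "x + v"]) (auto intro: integer_lattice_add)
    qed (use v in \<open>auto intro: integer_lattice_diff\<close>)
    moreover have "(\<lambda>x. u + x) ` integer_lattice = integer_lattice"
    proof (intro subset_antisym subsetI)
      fix x :: "real ^ 'n" assume "x \<in> integer_lattice"
      then show "x \<in> (\<lambda>x. u + x) ` integer_lattice"
        using u by (intro image_eqI[of _ _ "x - u"]) (auto intro: integer_lattice_diff)
    qed (use u in \<open>auto intro: integer_lattice_add\<close>)
    moreover have "g ` integer_lattice = integer_lattice"
    proof -
      have "g ` integer_lattice = N' ` L" by (simp add: g_def PW(3) image_comp)
      also have "\<dots> = integer_lattice" by (simp add: QX(3) image_image N')
      finally show ?thesis .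
    qed
    moreover have "\<phi> ` integer_lattice = (\<lambda>x. u + x) ` g ` (\<lambda>x. x - v) ` integer_lattice"
      by (simp add: image_image \<phi>)
    ultimately show ?thesis by simp
  qed
  moreover have "\<phi> ` P = Q"
  proof -
    have "\<phi> ` P = (\<lambda>x. (u - g v) + x) ` g ` (convex hull W)"
      by (simp add: image_image \<phi>_def PW(1) add.commute)
    also have "\<dots> = convex hull ((\<lambda>x. (u - g v) + x) ` g ` W)"
      by (simp only: convex_hull_linear_image[OF g(1)] convex_hull_translation)
    also have "(\<lambda>x. (u - g v) + x) ` g ` W = (\<lambda>z. u + N' z) ` V"
      by (simp add: image_image PW(2) g_def linear_diff[OF linN'] linear_diff[OF M(1)] algebra_simps)
    also have "\<dots> = X" by (simp add: QX(2) image_image N')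
    finally show ?thesis by (simp add: QX(1))
  qed
  ultimately show ?thesis using P(1) Q(1) unfolding unimodular_equivalence_def by blast
qed

text \<open>
  The coordinates are the inner products with a basis of normals in \<open>B\<close>, measured from a generating
  lattice point \<open>v\<close> of \<open>P\<close>; bounded widths become bounded coordinates.
\<close>
lemma coordinate_model_exists:
  fixes P :: "(real ^ 'n::finite) set"
  assumes P: "full_dim_lattice_polytope UNIV P"
    and B: "B \<subseteq> integer_lattice" "span B = UNIV" "\<And>b. b \<in> B \<Longrightarrow> width_on P b \<le> D"
  obtains V L where "coordinate_model P V L" "V \<subseteq> {x \<in> integer_lattice. \<forall>i. \<bar>x $ i\<bar> \<le> D}"
    "span V = UNIV" "add_subgroup L" "V \<subseteq> L" "L \<subseteq> integer_lattice"
proof -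
  have lat: "lattice_polytope UNIV P" and dim: "aff_dim P = int CARD('n)"
    using P by (auto simp: full_dim_lattice_polytope_def)
  obtain W where W: "W \<subseteq> integer_lattice" "P = convex hull W"
    using lattice_polytope_convex_hull[OF lat] by metis
  have "affine hull W = UNIV" using dim aff_dim_eq_full[of P] by (simp add: W(2))
  then obtain v where v: "v \<in> W" by (metis affine_hull_empty UNIV_not_empty ex_in_conv)
  have vZ: "v \<in> integer_lattice" using v W(1) by blast
  have spanW: "span ((\<lambda>w. w - v) ` W) = UNIV"
  proof -
    have "(\<lambda>x. v + x) ` span ((\<lambda>x. - v + x) ` (W - {v})) = UNIV"
      using affine_hull_span2[OF v] \<open>affine hull W = UNIV\<close> by simp
    then have "v + y \<in> (\<lambda>x. v + x) ` span ((\<lambda>x. - v + x) ` (W - {v}))" for y by simp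
    then have "y \<in> span ((\<lambda>x. - v + x) ` (W - {v}))" for y by force
    moreover have "span ((\<lambda>x. - v + x) ` (W - {v})) \<subseteq> span ((\<lambda>w. w - v) ` W)"
      by (intro span_mono) auto
    ultimately show ?thesis by blast
  qed
  obtain T where T: "T \<subseteq> B" "independent T" "B \<subseteq> span T"
    using maximal_independent_subset by blast
  have spanT: "span T = UNIV" using T(3) B(2) by (metis span_minimal subspace_span top.extremum_uniqueI)
  obtain h where h: "bij_betw h (UNIV :: 'n set) T"
    using basis_matrix[OF T(2) spanT] by blast
  have hB: "h i \<in> B" for i using h T(1) by (auto simp: bij_betw_def)
  define M where "M x = (\<chi> i. h i \<bullet> x)" for x
  have linM: "linear M" by (rule linearI) (auto simp: M_def vec_eq_iff inner_add_right)
  have "inj M"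
  proof (subst linear_injective_0[OF linM], intro allI impI)
    fix x assume "M x = 0"
    then have "orthogonal x t" if "t \<in> T" for t
      using that h by (auto simp: M_def vec_eq_iff orthogonal_def bij_betw_def inner_commute)
    then have "orthogonal x x" using orthogonal_to_span[of x T x] spanT by auto
    then show "x = 0" by (simp add: orthogonal_def)
  qed
  then have "bij M" using linM by (simp add: bij_def linear_injective_imp_surjective)
  have MZ: "M ` integer_lattice \<subseteq> integer_lattice"
  proof (intro image_subsetI)
    fix x :: "real ^ 'n" assume "x \<in> integer_lattice"
    then have "h i \<bullet> x \<in> \<int>" for i using hB B(1) by (intro integer_lattice_inner) auto
    then show "M x \<in> integer_lattice" by (simp add: M_def integer_lattice_iff)
  qed
  define V where "V = (\<lambda>w. M (w - v)) ` W"
  show ?thesis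
  proof (rule that)
    show "coordinate_model P V (M ` integer_lattice)"
      unfolding coordinate_model_def V_def using linM \<open>bij M\<close> vZ W(2) by blast
    show "V \<subseteq> M ` integer_lattice"
      using W(1) vZ by (auto simp: V_def intro!: imageI integer_lattice_diff)
    with MZ have "V \<subseteq> integer_lattice" by blast
    moreover have "\<bar>M (w - v) $ i\<bar> \<le> D" if "w \<in> W" for w i
    proof -
      have "w \<in> P" "v \<in> P" using that v by (auto simp: W(2) hull_inc)
      moreover have "compact P" using lat by (auto simp: lattice_polytope_def polytope_imp_compact)
      ultimately show ?thesis
        using inner_le_width_on[of P w v "h i"] inner_le_width_on[of P v w "h i"] B(3)[OF hB[of i]]
        by (simp add: M_def inner_diff_right)
    qed
    ultimately show "V \<subseteq> {x \<in> integer_lattice. \<forall>i. \<bar>x $ i\<bar> \<le> D}" by (auto simp: V_def)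
    have "V = M ` (\<lambda>w. w - v) ` W" by (simp add: V_def image_image)
    then show "span V = UNIV"
      using linear_span_image[OF linM, of "(\<lambda>w. w - v) ` W"] spanW \<open>bij M\<close> by (simp add: bij_is_surj)
    show "add_subgroup (M ` integer_lattice)"
      unfolding add_subgroup_def
    proof (intro conjI ballI)
      show "0 \<in> M ` integer_lattice" using linear_0[OF linM] integer_lattice_0 by (metis image_eqI)
      fix x y assume "x \<in> M ` integer_lattice" "y \<in> M ` integer_lattice"
      then show "x - y \<in> M ` integer_lattice"
        by (auto simp: linear_diff[OF linM, symmetric] intro!: imageI integer_lattice_diff)
    qed
    show "M ` integer_lattice \<subseteq> integer_lattice" by fact
  qed
qed

text \<open>
  There are finitely many sets \<open>V\<close> of lattice points in a box and, \<open>V\<close> being spanning, finitely many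
  lattices \<open>L\<close> between \<open>V\<close> and the integer lattice; and the pair determines the class.
\<close>
lemma finite_classes_bounded_width:
  "finite ({P :: (real ^ 'n::finite) set. full_dim_lattice_polytope UNIV P \<and>
     (\<exists>B\<subseteq>integer_lattice. span B = UNIV \<and> (\<forall>b\<in>B. width_on P b \<le> D))} // unimodular_equivalence)"
proof -
  define \<P> where "\<P> = {P :: (real ^ 'n) set. full_dim_lattice_polytope UNIV P \<and>
     (\<exists>B\<subseteq>integer_lattice. span B = UNIV \<and> (\<forall>b\<in>B. width_on P b \<le> D))}"
  define \<V> where "\<V> = {V. V \<subseteq> {x \<in> integer_lattice :: (real ^ 'n) set. \<forall>i. \<bar>x $ i\<bar> \<le> D} \<and> span V = UNIV}"
  define \<K> where "\<K> = (SIGMA V:\<V>. {L. add_subgroup L \<and> V \<subseteq> L \<and> L \<subseteq> integer_lattice})"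
  have "finite \<V>"
    unfolding \<V>_def
    by (rule finite_subset[of _ "Pow {x \<in> integer_lattice. \<forall>i. \<bar>x $ i\<bar> \<le> D}"])
       (auto simp: finite_lattice_box)
  then have "finite \<K>"
    unfolding \<K>_def by (intro finite_SigmaI finite_intermediate_lattices) (auto simp: \<V>_def)
  define R where "R P k = coordinate_model P (fst k) (snd k)" for P :: "(real ^ 'n) set" and k
  have "\<exists>k\<in>\<K>. R P k" if "P \<in> \<P>" for P
  proof -
    from that obtain B where P: "full_dim_lattice_polytope UNIV P"
      and B: "B \<subseteq> integer_lattice" "span B = UNIV" "\<forall>b\<in>B. width_on P b \<le> D"
      unfolding \<P>_def by blast
    obtain V L where "coordinate_model P V L" "V \<subseteq> {x \<in> integer_lattice. \<forall>i. \<bar>x $ i\<bar> \<le> D}"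
      "span V = UNIV" "add_subgroup L" "V \<subseteq> L" "L \<subseteq> integer_lattice"
      by (rule coordinate_model_exists[OF P B(1,2), of D]) (use B(3) in auto)
    then show ?thesis by (intro bexI[of _ "(V, L)"]) (auto simp: R_def \<K>_def \<V>_def)
  qed
  then have "\<forall>P\<in>\<P>. \<exists>k. k \<in> \<K> \<and> R P k" by blast
  from bchoice[OF this] obtain f where f: "\<And>P. P \<in> \<P> \<Longrightarrow> f P \<in> \<K> \<and> R P (f P)" by blast
  have eq: "unimodular_equivalence `` {P} = unimodular_equivalence `` {Q}"
    if "P \<in> \<P>" "Q \<in> \<P>" "f P = f Q" for P Q
  proof -
    have "(P, Q) \<in> unimodular_equivalence"
      using that f[OF that(1)] f[OF that(2)]
      by (intro same_model_imp_equivalent[of P "fst (f P)" "snd (f P)"])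
         (auto simp: R_def \<P>_def full_dim_lattice_polytope_def)
    then show ?thesis
      using unimodular_equivalence_sym unimodular_equivalence_trans by blast
  qed
  define cl where "cl k = unimodular_equivalence `` {SOME P. P \<in> \<P> \<and> f P = k}" for k
  have "\<P> // unimodular_equivalence \<subseteq> cl ` \<K>"
  proof
    fix X assume "X \<in> \<P> // unimodular_equivalence"
    then obtain P where P: "P \<in> \<P>" "X = unimodular_equivalence `` {P}" by (rule quotientE)
    have "(SOME Q. Q \<in> \<P> \<and> f Q = f P) \<in> \<P> \<and> f (SOME Q. Q \<in> \<P> \<and> f Q = f P) = f P"
      by (rule someI[of _ P]) (use P(1) in blast)
    then have "X = cl (f P)" unfolding cl_def P(2) using eq[OF P(1)] by simp
    then show "X \<in> cl ` \<K>" using f[OF P(1)] by blast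
  qed
  then have "finite (\<P> // unimodular_equivalence)" using finite_surj[OF \<open>finite \<K>\<close>] by blast
  then show ?thesis unfolding \<P>_def .
qed

section \<open>Finiteness of sporadic F-hollow polytopes\<close>

theorem theorem1p11:
  shows "finite ({P :: (real ^ 'n::finite) set. sporadic_F_hollow P} // unimodular_equivalence)"
proof -
  obtain D where D: "\<forall>P :: (real ^ 'n) set.
     compact P \<and> P \<noteq> {} \<and> F_hollow UNIV P \<and> relatively_nonhollow P \<longrightarrow>
     (\<exists>B\<subseteq>integer_lattice. span B = UNIV \<and> (\<forall>b\<in>B. width_on P b \<le> D))"
    using bounded_widths_on_spanning_set[where 'n='n] by (elim exE)
  let ?\<P> = "{P :: (real ^ 'n) set. full_dim_lattice_polytope UNIV P \<and>
     (\<exists>B\<subseteq>integer_lattice. span B = UNIV \<and> (\<forall>b\<in>B. width_on P b \<le> D))}"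
  have "{P. sporadic_F_hollow P} \<subseteq> ?\<P>"
  proof
    fix P :: "(real ^ 'n) set" assume "P \<in> {P. sporadic_F_hollow P}"
    then have P: "sporadic_F_hollow P" by simp
    then have "F_hollow UNIV P" "full_dim_lattice_polytope UNIV P"
      by (auto simp: sporadic_F_hollow_def)
    with D[rule_format, of P] sporadic_imp_compact[OF P] sporadic_imp_relatively_nonhollow[OF P]
    show "P \<in> ?\<P>" by simp
  qed
  then have "{P. sporadic_F_hollow P} // unimodular_equivalence \<subseteq> ?\<P> // unimodular_equivalence"
    unfolding quotient_def by (rule UN_mono[OF _ subset_refl])
  then show ?thesis using finite_classes_bounded_width by (rule finite_subset)
qed

end
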